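(* Let $G_1$ and $G_2$ be finite connected graphs (loops and multiple edges allowed), with no vertex of degree $1$, each of rank two. Then $G_1$ and $G_2$ are isomorphic if and only if $\zeta_{G_1}(u)=\zeta_{G_2}(u)$.
   Context: For a finite connected graph $G$ with vertex set $V$, edge set $E$ and no vertex of degree $1$, its rank is $r=|E|-|V|+1$. Let $\mathcal{A}$ be its adjacency matrix ($\mathcal{A}_{ij}$ = number of edges joining $v_i$ and $v_j$ for $i\neq j$; $\mathcal{A}_{ii}$ = twice the number of loops at $v_i$), and $\mathcal{Q}=D-I$ with $D$ the diagonal matrix of degrees (a loop contributes $2$ to the degree). The reciprocal Ihara zeta function is $\zeta_G(u)^{-1}=(1-u^2)^{r-1}\det(I-\mathcal{A}u+\mathcal{Q}u^2)$. *)

theory Defs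
  imports "HOL-Analysis.Analysis" "HOL-Library.Multiset"
begin

text \<open>A finite multigraph (loops and multiple edges allowed) with vertex set the
  finite type 'v, edge set E, and incidence map inc sending each edge to the
  multiset of its two endpoints (a loop at v has endpoints {#v,v#}).\<close>

definition multigraph :: "'e set \<Rightarrow> ('e \<Rightarrow> ('v::finite) multiset) \<Rightarrow> bool" where
  "multigraph E inc \<longleftrightarrow> finite E \<and> (\<forall>e\<in>E. size (inc e) = 2)"

text \<open>Degree: a loop contributes 2.\<close>
definition degree :: "'e set \<Rightarrow> ('e \<Rightarrow> ('v::finite) multiset) \<Rightarrow> 'v \<Rightarrow> nat" where
  "degree E inc v = (\<Sum>e\<in>E. count (inc e) v)"

definition adjacent :: "'e set \<Rightarrow> ('e \<Rightarrow> ('v::finite) multiset) \<Rightarrow> 'v \<Rightarrow> 'v \<Rightarrow> bool" where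
  "adjacent E inc v w \<longleftrightarrow> (\<exists>e\<in>E. inc e = {#v, w#})"

definition connected_graph :: "'e set \<Rightarrow> ('e \<Rightarrow> ('v::finite) multiset) \<Rightarrow> bool" where
  "connected_graph E inc \<longleftrightarrow> (\<forall>v w. (adjacent E inc)\<^sup>*\<^sup>* v w)"

definition graph_rank :: "'e set \<Rightarrow> ('e \<Rightarrow> ('v::finite) multiset) \<Rightarrow> int" where
  "graph_rank E inc = int (card E) - int CARD('v) + 1"

definition adj_matrix :: "'e set \<Rightarrow> ('e \<Rightarrow> ('v::finite) multiset) \<Rightarrow> real^'v^'v" where
  "adj_matrix E inc = (\<chi> i j. if i = j then 2 * real (card {e\<in>E. inc e = {#i, i#}})
                               else real (card {e\<in>E. inc e = {#i, j#}}))"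

definition Q_matrix :: "'e set \<Rightarrow> ('e \<Rightarrow> ('v::finite) multiset) \<Rightarrow> real^'v^'v" where
  "Q_matrix E inc = (\<chi> i j. if i = j then real (degree E inc i) - 1 else 0)"

definition ihara_zeta_recip :: "'e set \<Rightarrow> ('e \<Rightarrow> ('v::finite) multiset) \<Rightarrow> real \<Rightarrow> real" where
  "ihara_zeta_recip E inc u =
     (1 - u^2) powi (graph_rank E inc - 1) *
     det (mat 1 - u *\<^sub>R adj_matrix E inc + (u^2) *\<^sub>R Q_matrix E inc)"

definition ihara_zeta :: "'e set \<Rightarrow> ('e \<Rightarrow> ('v::finite) multiset) \<Rightarrow> real \<Rightarrow> real" where
  "ihara_zeta E inc u = inverse (ihara_zeta_recip E inc u)"

definition graph_iso ::
  "'e1 set \<Rightarrow> ('e1 \<Rightarrow> ('v1::finite) multiset) \<Rightarrow> 'e2 set \<Rightarrow> ('e2 \<Rightarrow> ('v2::finite) multiset) \<Rightarrow> bool" where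
  "graph_iso E1 inc1 E2 inc2 \<longleftrightarrow>
     (\<exists>f g. bij f \<and> bij_betw g E1 E2 \<and> (\<forall>e\<in>E1. inc2 (g e) = image_mset f (inc1 e)))"

end

theory Submission
  imports Defs
begin

text \<open>
  Contracting the vertices of degree two of a graph of rank two leaves two loops at one vertex
  (figure eight), two loops joined by an edge (dumbbell) or three parallel edges (theta), and the
  graph is determined by this shape and the lengths \<open>a, b, c\<close> of the contracted routes.
  If a route of length \<open>l\<close> carries the weight \<open>t = u\<^sup>l\<close>, then
  \<open>\<zeta>\<^sup>-\<^sup>1 = (\<Prod> (1 - t\<^sup>2)) det (I + W)\<close>, where each route adds \<open>t\<^sup>2 / (1 - t\<^sup>2)\<close> at the
  diagonal entry of each of its ends and \<open>- t / (1 - t\<^sup>2)\<close> at the two entries that join them: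
  this expression is invariant under contraction, as one sees by taking the Schur complement at
  the contracted vertex, and for routes of length 1 it is the definition of \<open>\<zeta>\<^sup>-\<^sup>1\<close>.
  With \<open>x = u\<^sup>a\<close>, \<open>y = u\<^sup>b\<close>, \<open>z = u\<^sup>c\<close> the three shapes give
  \<open>(1 - x)\<^sup>2 (1 - y)\<^sup>2 - 4 x y z\<^sup>2 (1 - x) (1 - y)\<close> for the dumbbell, the same with \<open>c = 0\<close> for the
  figure eight, and \<open>(1 - x y - y z - z x)\<^sup>2 - 4 x\<^sup>2 y\<^sup>2 z\<^sup>2\<close> for theta.
  The lowest terms of \<open>1 - \<surd>(\<zeta>\<^sup>-\<^sup>1)\<close> as \<open>u \<rightarrow> 0\<close> are \<open>u\<^sup>a + u\<^sup>b\<close> and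
  \<open>u\<^sup>a\<^sup>+\<^sup>b + u\<^sup>b\<^sup>+\<^sup>c + u\<^sup>c\<^sup>+\<^sup>a\<close> respectively.  They tell theta from the others, because its three
  exponents satisfy the strict triangle inequality, and they determine the lengths; in the case
  of a dumbbell, \<open>c\<close> can then be read off at \<open>u = 1/2\<close>.
\<close>

section \<open>Pivoting and reindexing determinants\<close>

text \<open>In the Leibniz sum a permutation that moves \<open>v\<close> contributes 0, and one that
  fixes \<open>v\<close> meets column \<open>v\<close> in no other row, so that column may be
  cleared too. The minor keeps its index type: row and column \<open>v\<close> become unit instead
  of being deleted.\<close>

lemma det_pivot_unit_row:
  fixes A :: "'a::comm_ring_1^'n^'n"
  assumes "\<And>j. j \<noteq> v \<Longrightarrow> A $ v $ j = 0"
  shows "det A = A $ v $ v * det (\<chi> i j. if i = v \<or> j = v then of_bool (i = j) else A $ i $ j)"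
    (is "_ = _ * det ?B")
proof -
  have "(\<Prod>i\<in>UNIV. A $ i $ p i) = A $ v $ v * (\<Prod>i\<in>UNIV. ?B $ i $ p i)"
    if p: "p permutes UNIV" for p
  proof (cases "p v = v")
    case True
    then have "p i \<noteq> v" if "i \<noteq> v" for i
      using that permutes_inj[OF p] by (metis injD)
    then have "(\<Prod>i\<in>UNIV - {v}. A $ i $ p i) = (\<Prod>i\<in>UNIV - {v}. ?B $ i $ p i)"
      by (intro prod.cong) auto
    then show ?thesis
      using True by (simp add: prod.remove[of UNIV v])
  next
    case False
    then show ?thesis
      using assms[of "p v"] by (simp add: prod.remove[of UNIV v])
  qed
  then show ?thesis
    unfolding det_def sum_distrib_left by (intro sum.cong) (simp_all add: mult_ac)
qed

text \<open>One step of Gaussian elimination as a factorisation \<open>A = L ** N\<close>: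
  \<open>L\<close> differs from the identity only in column \<open>v\<close>, and \<open>N\<close>
  has row \<open>v\<close> of \<open>A\<close> and the Schur complement in the other rows.\<close>

lemma det_schur_pivot:
  fixes A :: "'a::field^'n^'n"
  assumes nz: "A $ v $ v \<noteq> 0"
  shows "det A = A $ v $ v *
    det (\<chi> i j. if i = v \<or> j = v then of_bool (i = j)
                else A $ i $ j - A $ i $ v * A $ v $ j / A $ v $ v)" (is "_ = _ * det ?C")
proof -
  define L :: "'a^'n^'n" where
    "L = (\<chi> i j. if j = v \<and> i \<noteq> v then A $ i $ v / A $ v $ v else of_bool (i = j))"
  define N :: "'a^'n^'n" where
    "N = (\<chi> i j. if i = v then A $ v $ j else A $ i $ j - A $ i $ v * A $ v $ j / A $ v $ v)"
  have "A $ i $ j = (\<Sum>k\<in>UNIV. L $ i $ k * N $ k $ j)" for i j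
  proof (cases "i = v")
    case True
    then show ?thesis
      by (simp add: L_def N_def of_bool_def if_distrib[of "\<lambda>x. x * _"] cong: if_cong)
  next
    case False
    have "(\<Sum>k\<in>UNIV. L $ i $ k * N $ k $ j) = (\<Sum>k\<in>{i, v}. L $ i $ k * N $ k $ j)"
      by (rule sum.mono_neutral_right) (auto simp: L_def)
    then show ?thesis
      using False nz by (simp add: L_def N_def)
  qed
  then have "A = L ** N"
    by (simp add: vec_eq_iff matrix_matrix_mult_def)
  moreover have "det L = 1"
  proof -
    have "(\<chi> i j. if i = v \<or> j = v then of_bool (i = j) else L $ i $ j) = mat 1"
      by (auto simp: vec_eq_iff L_def mat_def)
    then show ?thesis
      using det_pivot_unit_row[of v L] by (simp add: L_def)
  qed
  moreover have "det N = A $ v $ v * det ?C"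
  proof -
    \<comment> \<open>Column \<open>v\<close> of \<open>N\<close> vanishes off the diagonal, whereas
      \<open>det_pivot_unit_row\<close> asks for such a row; hence the transposition.\<close>
    have "det N = det (transpose N)" by simp
    also have "\<dots> = A $ v $ v * det (transpose ?C)"
    proof (subst det_pivot_unit_row[of v])
      show "transpose N $ v $ j = 0" if "j \<noteq> v" for j
        using that nz by (simp add: transpose_def N_def)
      have "(\<chi> i j. if i = v \<or> j = v then of_bool (i = j) else transpose N $ i $ j) = transpose ?C"
        by (auto simp: vec_eq_iff transpose_def N_def)
      then show "transpose N $ v $ v *
          det (\<chi> i j. if i = v \<or> j = v then of_bool (i = j) else transpose N $ i $ j)
          = A $ v $ v * det (transpose ?C)"
        by (simp add: transpose_def N_def)
    qed
    finally show ?thesis by (simp only: det_transpose)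
  qed
  ultimately show ?thesis by (simp add: det_mul)
qed

lemma det_unit_outside_point:
  fixes A :: "'a::field^'n^'n"
  assumes "\<And>i j. i \<noteq> s \<or> j \<noteq> s \<Longrightarrow> A $ i $ j = of_bool (i = j)"
  shows "det A = A $ s $ s"
proof -
  have "(\<chi> i j. if i = s \<or> j = s then of_bool (i = j) else A $ i $ j) = mat 1"
    by (auto simp: vec_eq_iff mat_def assms)
  then show ?thesis
    using det_pivot_unit_row[of s A] assms[of s] by simp
qed

text \<open>Pivoting at \<open>t\<close> leaves a matrix that differs from the identity at most in
  its diagonal entry at \<open>s\<close>.\<close>

lemma det_unit_outside_pair:
  fixes A :: "'a::field^'n^'n"
  assumes "s \<noteq> t" "A $ t $ t \<noteq> 0"
    and unit: "\<And>i j. i \<notin> {s, t} \<or> j \<notin> {s, t} \<Longrightarrow> A $ i $ j = of_bool (i = j)"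
  shows "det A = A $ s $ s * A $ t $ t - A $ s $ t * A $ t $ s"
proof -
  let ?C = "\<chi> i j. if i = t \<or> j = t then of_bool (i = j)
                else A $ i $ j - A $ i $ t * A $ t $ j / A $ t $ t"
  have "det ?C = ?C $ s $ s"
  proof (rule det_unit_outside_point)
    fix i j assume "i \<noteq> s \<or> j \<noteq> s"
    then show "?C $ i $ j = of_bool (i = j)"
      using unit[of i j] unit[of i t] unit[of t j] by auto
  qed
  then show ?thesis
    using assms det_schur_pivot[of A t] by (simp add: field_simps)
qed

text \<open>The two index types may differ, so permutations are carried over by conjugation with
  \<open>f\<close>, which preserves signs.\<close>

lemma det_reindex:
  fixes A :: "'a::comm_ring_1^'n^'n" and f :: "'m::finite \<Rightarrow> 'n"
  assumes f: "bij f"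
  shows "det (\<chi> i j. A $ f i $ f j) = det A"
proof -
  have inj: "inj f" using f by (rule bij_is_inj)
  let ?\<phi> = "map_permutation UNIV f" and ?\<psi> = "map_permutation UNIV (inv f)"
  have "(\<Sum>p | p permutes UNIV. of_int (sign p) * (\<Prod>i\<in>UNIV. A $ f i $ f (p i))) =
        (\<Sum>p | p permutes UNIV. of_int (sign p) * (\<Prod>i\<in>UNIV. A $ i $ p i))"
  proof (rule sum.reindex_bij_witness[where i = ?\<psi> and j = ?\<phi>])
    fix p :: "'m \<Rightarrow> 'm" assume "p \<in> {p. p permutes UNIV}"
    then have p: "p permutes UNIV" by simp
    show "?\<psi> (?\<phi> p) = p"
      by (rule map_permutation_compose_inv[OF f p]) (simp add: inj)
    show "?\<phi> p \<in> {p. p permutes UNIV}"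
      using map_permutation_permutes[OF f p] by simp
    have "sign (?\<phi> p) = sign p"
      using sign_map_permutation[OF inj p] by simp
    moreover have "(\<Prod>i\<in>UNIV. A $ i $ ?\<phi> p i) = (\<Prod>i\<in>UNIV. A $ f i $ f (p i))"
      using prod.reindex_bij_betw[OF f, of "\<lambda>i. A $ i $ ?\<phi> p i"] inj
      by (simp add: map_permutation_apply)
    ultimately show "of_int (sign (?\<phi> p)) * (\<Prod>i\<in>UNIV. A $ i $ ?\<phi> p i) =
        of_int (sign p) * (\<Prod>i\<in>UNIV. A $ f i $ f (p i))" by simp
  next
    fix p :: "'n \<Rightarrow> 'n" assume "p \<in> {p. p permutes UNIV}"
    then have p: "p permutes UNIV" by simp
    have f': "bij (inv f)" using f by (rule bij_imp_bij_inv)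
    show "?\<phi> (?\<psi> p) = p"
      by (rule map_permutation_compose_inv[OF f' p]) (simp add: f bij_is_surj surj_f_inv_f)
    show "?\<psi> p \<in> {p. p permutes UNIV}"
      using map_permutation_permutes[OF f' p] by simp
  qed
  then show ?thesis by (simp add: det_def)
qed

lemma det_scaleR:
  fixes A :: "real^'n^'n"
  shows "det (c *\<^sub>R A) = c ^ CARD('n) * det A"
proof -
  have "c *\<^sub>R A = (\<chi> i. c *s A $ i)"
    by (simp add: vec_eq_iff)
  then show ?thesis
    using det_rows_mul[of "\<lambda>_. c" "\<lambda>i. A $ i"] by simp
qed

section \<open>Recovering exponents\<close>

text \<open>Letting \<open>u\<close> tend to 0 from the right kills the constant coefficient;
  dividing by \<open>u\<close> then lowers \<open>N\<close> by one.\<close>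

lemma coeff_eq_0_of_bound:
  fixes p :: "real poly"
  assumes "0 < \<delta>" "\<And>u. 0 < u \<Longrightarrow> u < \<delta> \<Longrightarrow> \<bar>poly p u\<bar> \<le> C * u ^ N" "k < N"
  shows "coeff p k = 0"
  using assms(2,3)
proof (induction N arbitrary: p k)
  case (Suc N)
  obtain a q where p: "p = pCons a q" by (cases p)
  have ev: "\<forall>\<^sub>F u in at_right 0. 0 < u \<and> u < \<delta>"
    using \<open>0 < \<delta>\<close> by (simp add: eventually_at_right) blast
  have "((\<lambda>u. C * u ^ Suc N) \<longlongrightarrow> C * 0 ^ Suc N) (at_right 0)"
    by (intro tendsto_intros)
  then have "((\<lambda>u. C * u ^ Suc N) \<longlongrightarrow> 0) (at_right 0)" by simp
  then have "(poly p \<longlongrightarrow> 0) (at_right 0)"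
    by (rule Lim_null_comparison[rotated]) (use ev Suc.prems(1) in \<open>auto elim!: eventually_mono\<close>)
  moreover have "(poly p \<longlongrightarrow> poly p 0) (at_right 0)"
    by (intro tendsto_intros)
  ultimately have "poly p 0 = 0"
    using tendsto_unique[OF trivial_limit_at_right_real] by blast
  then have a: "a = 0" by (simp add: p)
  have "\<bar>poly q u\<bar> \<le> C * u ^ N" if "0 < u" "u < \<delta>" for u
    using Suc.prems(1)[OF that] that by (simp add: p a abs_mult mult.left_commute[of C])
  then show ?case
    using Suc.IH[of q] Suc.prems(2) by (cases k) (auto simp: p a)
qed simp

text \<open>The power sum of a multiset is the polynomial whose coefficients are the
  multiplicities.\<close>

lemma count_eq_of_power_sums_close:
  fixes A B :: "nat multiset"
  assumes "0 < \<delta>"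
    and close: "\<And>u::real. 0 < u \<Longrightarrow> u < \<delta> \<Longrightarrow> \<bar>(\<Sum>e\<in>#A. u ^ e) - (\<Sum>e\<in>#B. u ^ e)\<bar> \<le> C * u ^ N"
    and "k < N"
  shows "count A k = count B k"
proof -
  define P :: "nat multiset \<Rightarrow> real poly" where "P = (\<lambda>A. \<Sum>e\<in>#A. monom 1 e)"
  have poly: "poly (P A) u = (\<Sum>e\<in>#A. u ^ e)" for A u
    by (induction A) (simp_all add: P_def poly_monom)
  have coeff: "coeff (P A) k = real (count A k)" for A
    by (induction A) (auto simp: P_def)
  have "coeff (P A - P B) k = 0"
    by (rule coeff_eq_0_of_bound[OF assms(1) _ assms(3)]) (use close in \<open>simp add: poly\<close>)
  then show ?thesis by (simp add: coeff)
qed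

text \<open>Extracting the square root of \<open>f\<close> recovers \<open>A\<close> as the multiset of exponents of \<open>1 - \<surd>f\<close>
  up to order \<open>u\<^sup>M\<close>.\<close>

definition near_square :: "nat multiset \<Rightarrow> nat \<Rightarrow> (real \<Rightarrow> real) \<Rightarrow> bool" where
  "near_square A M f \<longleftrightarrow> (\<forall>u. 0 < u \<longrightarrow> u < 1/8 \<longrightarrow>
     (\<exists>Q R. f u = (1 - Q)\<^sup>2 - R \<and> 0 \<le> Q \<and> Q \<le> 3 * u \<and> \<bar>R\<bar> \<le> 4 * u ^ M
          \<and> \<bar>Q - (\<Sum>e\<in>#A. u ^ e)\<bar> \<le> u ^ M))"

text \<open>Equating the two expressions gives \<open>(Q' - Q) * (2 - Q - Q') = R - R'\<close>. The
  second factor stays away from 0, so \<open>Q' - Q\<close> is as small as the remainders, and the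
  two power sums agree up to order \<open>min M N\<close>.\<close>

lemma near_square_unique:
  assumes f: "near_square A M f" and g: "near_square B N g"
    and eq: "\<And>u. 0 < u \<Longrightarrow> u < 1 \<Longrightarrow> f u = g u"
  shows "filter_mset (\<lambda>k. k < min M N) A = filter_mset (\<lambda>k. k < min M N) B"
proof -
  have "count A k = count B k" if "k < min M N" for k
  \<comment> \<open>The constant is 10 = 4 + 4 + 1 + 1: two remainders and two errors of
    approximation.\<close>
  proof (rule count_eq_of_power_sums_close[OF _ _ that, of "1/8" A B 10])
    fix u :: real assume u: "0 < u" "u < 1/8"
    obtain Q R where Q: "f u = (1 - Q)\<^sup>2 - R" "0 \<le> Q" "Q \<le> 3 * u" "\<bar>R\<bar> \<le> 4 * u ^ M"
        "\<bar>Q - (\<Sum>e\<in>#A. u ^ e)\<bar> \<le> u ^ M"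
      using f u unfolding near_square_def by blast
    obtain Q' R' where Q': "g u = (1 - Q')\<^sup>2 - R'" "0 \<le> Q'" "Q' \<le> 3 * u" "\<bar>R'\<bar> \<le> 4 * u ^ N"
        "\<bar>Q' - (\<Sum>e\<in>#B. u ^ e)\<bar> \<le> u ^ N"
      using g u unfolding near_square_def by blast
    have "(1 - Q)\<^sup>2 - R = (1 - Q')\<^sup>2 - R'"
      using Q(1) Q'(1) eq[of u] u by simp
    then have *: "(Q' - Q) * (2 - Q - Q') = R - R'"
      by (simp add: power2_eq_square algebra_simps)
    \<comment> \<open>Both \<open>Q\<close> and \<open>Q'\<close> are at most \<open>3 * u\<close>,
      hence below 3/8, so \<open>2 - Q - Q'\<close> is at least 1.\<close>
    have "\<bar>Q' - Q\<bar> * 1 \<le> \<bar>Q' - Q\<bar> * \<bar>2 - Q - Q'\<bar>"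
      using Q(3) Q'(3) u by (intro mult_left_mono) auto
    also have "\<dots> = \<bar>R - R'\<bar>"
      by (simp add: * flip: abs_mult)
    finally have "\<bar>Q' - Q\<bar> \<le> \<bar>R - R'\<bar>" by simp
    moreover have "u ^ M \<le> u ^ min M N" "u ^ N \<le> u ^ min M N"
      using u by (auto intro!: power_decreasing)
    ultimately show "\<bar>(\<Sum>e\<in>#A. u ^ e) - (\<Sum>e\<in>#B. u ^ e)\<bar> \<le> 10 * u ^ min M N"
      using Q(4,5) Q'(4,5) by linarith
  qed simp
  then show ?thesis
    by (intro multiset_eqI) simp
qed

section \<open>The reciprocal zeta functions of the three shapes and their lengths\<close>

definition dumbbell_poly :: "nat \<Rightarrow> nat \<Rightarrow> nat \<Rightarrow> real \<Rightarrow> real" where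
  "dumbbell_poly a b c u = (let x = u ^ a; y = u ^ b; z = u ^ c in
     ((1 - x) * (1 - y))\<^sup>2 - 4 * x * y * z\<^sup>2 * (1 - x) * (1 - y))"

definition theta_poly :: "nat \<Rightarrow> nat \<Rightarrow> nat \<Rightarrow> real \<Rightarrow> real" where
  "theta_poly a b c u = (let x = u ^ a; y = u ^ b; z = u ^ c in
     (1 - (x * y + y * z + z * x))\<^sup>2 - 4 * (x * y * z)\<^sup>2)"

text \<open>Here \<open>Q\<close> is given by \<open>(1 - x) * (1 - y) = 1 - Q\<close>. It differs
  from \<open>x + y\<close> by \<open>x * y = u ^ (a + b)\<close>, and the remainder carries the
  same factor.\<close>

lemma near_square_dumbbell:
  assumes "0 < a" "0 < b"
  shows "near_square {#a, b#} (a + b) (dumbbell_poly a b c)"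
  unfolding near_square_def
proof (intro allI impI)
  fix u :: real assume u: "0 < u" "u < 1/8"
  define x y z where xyz: "x = u ^ a" "y = u ^ b" "z = u ^ c"
  have x: "0 < x" "x \<le> u" and y: "0 < y" "y \<le> u" and z: "0 < z" "z \<le> 1"
    using u assms power_decreasing[of 1 a u] power_decreasing[of 1 b u]
    by (auto simp: xyz intro: power_le_one)
  have xy: "0 < x * y" "x * y \<le> x"
    using x y u by (auto intro: mult_left_le)
  define R where "R = 4 * x * y * z\<^sup>2 * (1 - x) * (1 - y)"
  have "\<bar>z\<^sup>2 * (1 - x) * (1 - y)\<bar> \<le> 1"
    using x y z u by (auto simp: abs_mult power_le_one intro!: mult_le_one)
  then have "(x * y) * \<bar>z\<^sup>2 * (1 - x) * (1 - y)\<bar> \<le> x * y"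
    using xy by (intro mult_left_le) auto
  moreover have "\<bar>R\<bar> = 4 * ((x * y) * \<bar>z\<^sup>2 * (1 - x) * (1 - y)\<bar>)"
    using x y by (simp add: R_def abs_mult)
  ultimately have "\<bar>R\<bar> \<le> 4 * u ^ (a + b)"
    by (simp add: xyz power_add)
  moreover have "dumbbell_poly a b c u = (1 - (x + y - x * y))\<^sup>2 - R"
    by (simp add: dumbbell_poly_def Let_def R_def flip: xyz) (simp add: power2_eq_square algebra_simps)
  moreover have "x * y = u ^ (a + b)" by (simp add: xyz power_add)
  ultimately show "\<exists>Q R. dumbbell_poly a b c u = (1 - Q)\<^sup>2 - R \<and> 0 \<le> Q \<and> Q \<le> 3 * u \<and>
      \<bar>R\<bar> \<le> 4 * u ^ (a + b) \<and> \<bar>Q - (\<Sum>e\<in>#{#a, b#}. u ^ e)\<bar> \<le> u ^ (a + b)"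
    using x y xy
    by - (rule exI[of _ "x + y - x * y"], rule exI[of _ R], auto simp flip: xyz)
qed

text \<open>Here \<open>Q\<close> is exactly the power sum, and only the remainder
  \<open>4 * (x * y * z)\<^sup>2\<close> limits the order.\<close>

lemma near_square_theta:
  assumes "0 < a" "0 < b" "0 < c"
  shows "near_square {#a + b, b + c, c + a#} (2 * (a + b + c)) (theta_poly a b c)"
  unfolding near_square_def
proof (intro allI impI)
  fix u :: real assume u: "0 < u" "u < 1/8"
  define x y z where xyz: "x = u ^ a" "y = u ^ b" "z = u ^ c"
  have x: "0 < x" "x \<le> u" and y: "0 < y" "y \<le> u" and z: "0 < z" "z \<le> u"
    using u assms power_decreasing[of 1 a u] power_decreasing[of 1 b u] power_decreasing[of 1 c u]
    by (auto simp: xyz)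
  have "x * y \<le> x" "y * z \<le> y" "z * x \<le> z"
    using x y z u by (auto intro: mult_left_le)
  then have "x * y + y * z + z * x \<le> 3 * u"
    using x y z by linarith
  moreover have "(\<Sum>e\<in>#{#a + b, b + c, c + a#}. u ^ e) = x * y + y * z + z * x"
    by (simp add: xyz power_add)
  moreover have "(x * y * z)\<^sup>2 = u ^ (2 * (a + b + c))"
    by (simp only: xyz flip: power_add power_mult) (simp add: mult.commute)
  moreover have "0 < x * y" "0 < y * z" "0 < z * x" using x y z by auto
  ultimately show "\<exists>Q R. theta_poly a b c u = (1 - Q)\<^sup>2 - R \<and> 0 \<le> Q \<and> Q \<le> 3 * u \<and>
      \<bar>R\<bar> \<le> 4 * u ^ (2 * (a + b + c)) \<and>
      \<bar>Q - (\<Sum>e\<in>#{#a + b, b + c, c + a#}. u ^ e)\<bar> \<le> u ^ (2 * (a + b + c))"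
    using x y z u
    by - (rule exI[of _ "x * y + y * z + z * x"], rule exI[of _ "4 * (x * y * z)\<^sup>2"],
      auto simp: theta_poly_def Let_def simp flip: xyz)
qed

lemma theta_poly_neq_dumbbell_poly:
  assumes pos: "0 < a" "0 < b" "0 < c" "0 < p" "0 < q"
    and eq: "\<And>u. 0 < u \<Longrightarrow> u < 1 \<Longrightarrow> theta_poly a b c u = dumbbell_poly p q r u"
  shows False
proof -
  let ?m = "min (2 * (a + b + c)) (p + q)"
  have eq': "filter_mset (\<lambda>k. k < ?m) {#a + b, b + c, c + a#} = filter_mset (\<lambda>k. k < ?m) {#p, q#}"
    by (rule near_square_unique[OF near_square_theta near_square_dumbbell eq]) (use pos in auto)
  show False
  proof (cases "2 * (a + b + c) \<le> p + q")
    case True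
    \<comment> \<open>All three theta exponents lie below the common order, but at most two can
      occur on the other side.\<close>
    then have "filter_mset (\<lambda>k. k < ?m) {#a + b, b + c, c + a#} = {#a + b, b + c, c + a#}"
      using pos by simp
    with eq' have "size {#a + b, b + c, c + a#} \<le> size {#p, q#}"
      by (metis multiset_filter_subset size_mset_mono)
    then show False by simp
  next
    case False
    then have "?m = p + q" by simp
    moreover have "filter_mset (\<lambda>k. k < p + q) {#p, q#} = {#p, q#}"
      using pos by simp
    ultimately have "filter_mset (\<lambda>k. k < p + q) {#a + b, b + c, c + a#} = {#p, q#}"
      using eq' by metis
    \<comment> \<open>Exactly two theta exponents lie below \<open>p + q\<close>, and they are
      \<open>p\<close> and \<open>q\<close>. The third is then at least their sum, against the
      strict triangle inequality.\<close>
    then show False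
      using pos by (auto split: if_splits simp: add_eq_conv_ex)
  qed
qed

lemma filter_mset_eq_self_of_size:
  "filter_mset P B = A \<Longrightarrow> size A = size B \<Longrightarrow> A = B"
  by (metis multiset_filter_subset mset_subset_size subset_mset.le_imp_less_or_eq nat_neq_iff)

text \<open>Truncation at the smaller order keeps one multiset whole; since the sizes agree, it
  cannot have cut anything from the other.\<close>

lemma near_square_inj:
  assumes f: "near_square A M f" "\<And>k. k \<in># A \<Longrightarrow> k < M"
    and g: "near_square B N g" "\<And>k. k \<in># B \<Longrightarrow> k < N"
    and eq: "\<And>u. 0 < u \<Longrightarrow> u < 1 \<Longrightarrow> f u = g u" and size: "size A = size B"
  shows "A = B"
proof (cases "M \<le> N")
  case True
  then have "filter_mset (\<lambda>k. k < min M N) A = A"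
    using f(2) by (simp add: filter_mset_eq_conv)
  then have "filter_mset (\<lambda>k. k < min M N) B = A"
    using near_square_unique[OF f(1) g(1) eq] by simp
  then show ?thesis using size by (rule filter_mset_eq_self_of_size)
next
  case False
  then have "filter_mset (\<lambda>k. k < min M N) B = B"
    using g(2) by (simp add: filter_mset_eq_conv)
  then have "filter_mset (\<lambda>k. k < min M N) A = B"
    using near_square_unique[OF f(1) g(1) eq] by simp
  then show ?thesis using size filter_mset_eq_self_of_size by metis
qed

lemma theta_poly_inj:
  assumes pos: "0 < a" "0 < b" "0 < c" "0 < p" "0 < q" "0 < r"
    and eq: "\<And>u. 0 < u \<Longrightarrow> u < 1 \<Longrightarrow> theta_poly a b c u = theta_poly p q r u"
  shows "{#a, b, c#} = {#p, q, r#}"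
proof -
  have *: "{#a + b, b + c, c + a#} = {#p + q, q + r, r + p#}"
    by (rule near_square_inj[OF near_square_theta _ near_square_theta _ eq]) (use pos in auto)
  then have "sum_mset {#a + b, b + c, c + a#} = sum_mset {#p + q, q + r, r + p#}"
    by (rule arg_cong)
  then have sum: "p + q + r = a + b + c" by simp
  \<comment> \<open>Subtracting a sum of two lengths from the total leaves the third length.\<close>
  have "image_mset (\<lambda>x. a + b + c - x) {#a + b, b + c, c + a#} =
        image_mset (\<lambda>x. p + q + r - x) {#p + q, q + r, r + p#}"
    by (simp only: * sum)
  then show ?thesis by (simp add: add_mset_commute)
qed

text \<open>The values \<open>c = 0\<close> and \<open>r = 0\<close> are allowed, so this covers
  figure eights and also separates them from dumbbells.\<close>

lemma dumbbell_poly_inj: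
  assumes pos: "0 < a" "0 < b" "0 < p" "0 < q"
    and eq: "\<And>u. 0 < u \<Longrightarrow> u < 1 \<Longrightarrow> dumbbell_poly a b c u = dumbbell_poly p q r u"
  shows "{#a, b#} = {#p, q#} \<and> c = r"
proof
  show ab: "{#a, b#} = {#p, q#}"
    by (rule near_square_inj[OF near_square_dumbbell _ near_square_dumbbell _ eq]) (use pos in auto)
  have "dumbbell_poly a b c (1/2) = dumbbell_poly a b r (1/2)"
    using ab eq[of "1/2"] by (auto simp: add_eq_conv_ex dumbbell_poly_def Let_def mult_ac)
  \<comment> \<open>At \<open>u = 1/2\<close> neither \<open>x\<close> nor \<open>y\<close> is 1, so
    the coefficient \<open>4 * x * y * (1 - x) * (1 - y)\<close> of \<open>z\<^sup>2\<close> is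
    nonzero and can be cancelled.\<close>
  moreover have "(1/2) ^ n < (1::real)" if "0 < n" for n
    using power_strict_decreasing[of 0 n "1/2::real"] that by simp
  then have "(1/2) ^ a \<noteq> (1::real)" "(1/2) ^ b \<noteq> (1::real)"
    using pos by (metis less_irrefl)+
  ultimately have "((1/2::real) ^ c)\<^sup>2 = ((1/2) ^ r)\<^sup>2"
    by (simp add: dumbbell_poly_def Let_def)
  then have "(1/2::real) ^ (2 * c) = (1/2) ^ (2 * r)"
    by (simp add: mult.commute flip: power_mult)
  then show "c = r"
    by (simp add: power_inject_exp')
qed

section \<open>Decomposition into routes\<close>

text \<open>A contracted path with an arbitrarily chosen direction. The vertices and edges swallowed
  by the contraction are recorded, because an isomorphism of the original graphs has to be rebuilt
  from them.\<close>

datatype ('v, 'e) route =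
  Route (src: 'v) (mids: "'v list") (tgt: 'v) (edges: "'e list")

fun links :: "'v list \<Rightarrow> 'v multiset list" where
  "links (v # w # vs) = {#v, w#} # links (w # vs)"
| "links _ = []"

lemma links_map: "links (map f vs) = map (image_mset f) (links vs)"
  by (induction vs rule: links.induct) auto

lemma links_append: "links (vs @ v # ws) = links (vs @ [v]) @ links (v # ws)"
  by (induction vs rule: links.induct) auto

lemma links_rev: "links (rev vs) = rev (links vs)"
proof (induction vs rule: links.induct)
  case (1 v w vs)
  then show ?case
    using links_append[of "rev vs" w "[v]"] by (simp add: add_mset_commute)
qed auto

lemma length_links: "length (links vs) = length vs - 1"
  by (induction vs rule: links.induct) auto

text \<open>The vertex set of the contracted graph.\<close>

definition core :: "('v, 'e) route list \<Rightarrow> 'v set" where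
  "core ps = - (\<Union>p\<in>set ps. set (mids p))"

definition is_route :: "('e \<Rightarrow> 'v multiset) \<Rightarrow> ('v, 'e) route \<Rightarrow> bool" where
  "is_route inc p \<longleftrightarrow> map inc (edges p) = links (src p # mids p @ [tgt p])"

definition route_decomp :: "'e set \<Rightarrow> ('e \<Rightarrow> 'v multiset) \<Rightarrow> ('v, 'e) route list \<Rightarrow> bool" where
  "route_decomp E inc ps \<longleftrightarrow>
     distinct (concat (map mids ps)) \<and> distinct (concat (map edges ps)) \<and>
     set (concat (map edges ps)) = E \<and>
     (\<forall>p\<in>set ps. {src p, tgt p} \<subseteq> core ps \<and> is_route inc p)"

lemma length_edges: "is_route inc p \<Longrightarrow> length (edges p) = Suc (length (mids p))"
  unfolding is_route_def using length_links[of "src p # mids p @ [tgt p]"]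
  by (metis Suc_eq_plus1 diff_Suc_1 length_Cons length_append_singleton length_map)

section \<open>Isomorphism from matching decompositions\<close>

lemma ex_bij_betw_map_eq:
  assumes "length xs = length ys" "distinct xs" "distinct ys"
  shows "\<exists>f. bij_betw f (set xs) (set ys) \<and> map f xs = ys"
  using assms
proof (induction xs ys rule: list_induct2)
  case (Cons x xs y ys)
  then obtain f where f: "bij_betw f (set xs) (set ys)" "map f xs = ys" by auto
  then have map: "map (f(x := y)) xs = ys"
    using Cons.prems by (auto simp: map_fun_upd)
  then have "bij_betw (f(x := y)) (set xs) (set ys)"
    using f by (metis Cons.prems(1) bij_betw_cong distinct.simps(2) fun_upd_other)
  then have "bij_betw (f(x := y)) (set xs \<union> {x}) (set ys \<union> {y})"
    by (rule bij_betw_combine) (use Cons.prems in auto)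
  then show ?case
    using map by (intro exI[of _ "f(x := y)"]) (simp del: fun_upd_apply, simp)
qed (simp add: bij_betw_def)

lemma map_concat_eq_pieces:
  assumes "list_all2 (\<lambda>p q. length (F p) = length (G q)) ps qs"
    and "map f (concat (map F ps)) = concat (map G qs)"
  shows "list_all2 (\<lambda>p q. map f (F p) = G q) ps qs"
  using assms by (induction ps qs rule: list_all2_induct) auto

definition same_shape :: "('v \<Rightarrow> 'w) \<Rightarrow> ('v, 'e) route \<Rightarrow> ('w, 'd) route \<Rightarrow> bool" where
  "same_shape h p q \<longleftrightarrow>
     length (edges p) = length (edges q) \<and> src q = h (src p) \<and> tgt q = h (tgt p)"

text \<open>Corresponding routes have equally many edges, hence equally many interior vertices. The
  concatenated lists are therefore distinct and of equal length, and matching them in order gives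
  the edge bijection and the vertex bijection outside the core; \<open>h\<close> supplies the
  rest.\<close>

lemma graph_iso_if_same_shape:
  fixes inc1 :: "'e1 \<Rightarrow> ('v1::finite) multiset" and inc2 :: "'e2 \<Rightarrow> ('v2::finite) multiset"
  assumes ps: "route_decomp E1 inc1 ps" and qs: "route_decomp E2 inc2 qs"
    and h: "bij_betw h (core ps) (core qs)" and shape: "list_all2 (same_shape h) ps qs"
  shows "graph_iso E1 inc1 E2 inc2"
proof -
  have routes: "list_all2 (\<lambda>p q. same_shape h p q \<and> is_route inc1 p \<and> is_route inc2 q
      \<and> src p \<in> core ps \<and> tgt p \<in> core ps) ps qs"
    using shape ps qs unfolding route_decomp_def list_all2_conv_all_nth by auto
  have mids: "list_all2 (\<lambda>p q. length (mids p) = length (mids q)) ps qs"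
    using routes by (rule list_all2_mono) (auto simp: same_shape_def dest!: length_edges)
  have edges: "list_all2 (\<lambda>p q. length (edges p) = length (edges q)) ps qs"
    using routes by (rule list_all2_mono) (auto simp: same_shape_def)
  have len: "length (concat (map F ps)) = length (concat (map G qs))"
    if "list_all2 (\<lambda>p q. length (F p) = length (G q)) ps qs"
    for F :: "_ \<Rightarrow> 'a list" and G :: "_ \<Rightarrow> 'b list"
    using that by (induction ps qs rule: list_all2_induct) auto
  obtain f0 where f0: "bij_betw f0 (set (concat (map mids ps))) (set (concat (map mids qs)))"
      "map f0 (concat (map mids ps)) = concat (map mids qs)"
    using ex_bij_betw_map_eq[OF len[OF mids]] ps qs by (auto simp: route_decomp_def)
  obtain g where g: "bij_betw g (set (concat (map edges ps))) (set (concat (map edges qs)))"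
      "map g (concat (map edges ps)) = concat (map edges qs)"
    using ex_bij_betw_map_eq[OF len[OF edges]] ps qs by (auto simp: route_decomp_def)
  define f where "f = (\<lambda>v. if v \<in> core ps then h v else f0 v)"
  have not_core: "v \<notin> core ps" if "v \<in> set (concat (map mids ps))" for v
    using that by (auto simp: core_def)
  have map_f: "map f (concat (map mids ps)) = concat (map mids qs)"
    unfolding f0(2)[symmetric] by (rule map_cong) (simp_all add: f_def not_core)
  have "bij_betw f (core ps) (core qs)"
    using h by (rule bij_betw_cong[THEN iffD1, rotated]) (simp add: f_def)
  moreover have "bij_betw f (set (concat (map mids ps))) (set (concat (map mids qs)))"
    using f0(1) by (rule bij_betw_cong[THEN iffD1, rotated]) (simp add: f_def not_core)
  ultimately have "bij_betw f (core ps \<union> set (concat (map mids ps)))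
      (core qs \<union> set (concat (map mids qs)))"
    by (rule bij_betw_combine) (auto simp: core_def)
  moreover have "core ps \<union> set (concat (map mids ps)) = UNIV"
      "core qs \<union> set (concat (map mids qs)) = UNIV"
    by (auto simp: core_def)
  ultimately have "bij f" by simp
  have "list_all2 (\<lambda>p q. (same_shape h p q \<and> is_route inc1 p \<and> is_route inc2 q
      \<and> src p \<in> core ps \<and> tgt p \<in> core ps) \<and> map f (mids p) = mids q) ps qs"
    using routes map_concat_eq_pieces[OF mids map_f] unfolding list_all2_conv_all_nth by blast
  \<comment> \<open>Along each route \<open>f\<close> maps the vertex sequence to the vertex
    sequence, and \<open>links\<close> commutes with such a map.\<close>
  then have "list_all2 (\<lambda>p q. map inc2 (edges q) = map (image_mset f) (map inc1 (edges p))) ps qs"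
  proof (rule list_all2_mono, elim conjE)
    fix p q assume "same_shape h p q" "is_route inc1 p" "is_route inc2 q"
      "src p \<in> core ps" "tgt p \<in> core ps" "map f (mids p) = mids q"
    then have "src q # mids q @ [tgt q] = map f (src p # mids p @ [tgt p])"
      by (simp add: same_shape_def f_def)
    then show "map inc2 (edges q) = map (image_mset f) (map inc1 (edges p))"
      using \<open>is_route inc1 p\<close> \<open>is_route inc2 q\<close> unfolding is_route_def
      by (simp only: links_map)
  qed
  then have "map inc2 (concat (map edges qs)) = map (image_mset f) (map inc1 (concat (map edges ps)))"
    by (induction ps qs rule: list_all2_induct) auto
  then have "map (\<lambda>e. inc2 (g e)) (concat (map edges ps))
      = map (\<lambda>e. image_mset f (inc1 e)) (concat (map edges ps))"
    by (simp only: g(2)[symmetric] map_map o_def)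
  then have "\<forall>e\<in>set (concat (map edges ps)). inc2 (g e) = image_mset f (inc1 e)"
    by (simp only: map_eq_conv)
  then show ?thesis
    using \<open>bij f\<close> g(1) ps qs unfolding graph_iso_def route_decomp_def by auto
qed

section \<open>Elimination of vertices of degree two\<close>

text \<open>A loop satisfies both conditions in each sum, which accounts for its factor 2.\<close>

definition weight :: "real \<Rightarrow> ('v, 'e) route \<Rightarrow> 'v \<Rightarrow> 'v \<Rightarrow> real" where
  "weight u p i j = (let t = u ^ length (edges p) in
     of_bool (i = j) * (of_bool (i = src p) + of_bool (i = tgt p)) * (t\<^sup>2 / (1 - t\<^sup>2))
     - (of_bool (i = src p \<and> j = tgt p) + of_bool (i = tgt p \<and> j = src p)) * (t / (1 - t\<^sup>2)))"

definition route_matrix :: "real \<Rightarrow> ('v::finite, 'e) route list \<Rightarrow> real^'v^'v" where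
  "route_matrix u ps = (\<chi> i j. of_bool (i = j) + (\<Sum>p\<leftarrow>ps. weight u p i j))"

definition route_zeta :: "('v::finite, 'e) route list \<Rightarrow> real \<Rightarrow> real" where
  "route_zeta ps u = (\<Prod>p\<leftarrow>ps. 1 - (u ^ length (edges p))\<^sup>2) * det (route_matrix u ps)"

definition ends :: "('v, 'e) route list \<Rightarrow> 'v \<Rightarrow> nat" where
  "ends ps v = (\<Sum>p\<leftarrow>ps. of_bool (src p = v) + of_bool (tgt p = v))"

text \<open>Connectedness of the contracted graph through unions of components instead of walks; in
  this form it passes easily to a merged route.\<close>

definition route_connected :: "('v, 'e) route list \<Rightarrow> bool" where
  "route_connected ps \<longleftrightarrow> (\<forall>S \<subseteq> core ps. S \<noteq> {} \<longrightarrow> (\<forall>p\<in>set ps. src p \<in> S \<longleftrightarrow> tgt p \<in> S) \<longrightarrow> S = core ps)"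

text \<open>The invariant of contraction. The equation for \<open>length ps\<close> says that the
  contracted graph has rank two. Zeta values are compared only for \<open>0 < u < 1\<close>, where
  no denominator \<open>1 - t\<^sup>2\<close> of a route with an edge vanishes.\<close>

definition presents ::
  "'e set \<Rightarrow> ('e \<Rightarrow> 'v multiset) \<Rightarrow> (real \<Rightarrow> real) \<Rightarrow> ('v::finite, 'e) route list \<Rightarrow> bool" where
  "presents E inc f ps \<longleftrightarrow> route_decomp E inc ps \<and> route_connected ps \<and>
     length ps = Suc (card (core ps)) \<and> (\<forall>v\<in>core ps. 2 \<le> ends ps v) \<and>
     (\<forall>u. 0 < u \<longrightarrow> u < 1 \<longrightarrow> route_zeta ps u = f u)"

section \<open>Independence of the order and direction of routes\<close>

lemma sum_list_mset_cong: "mset ps = mset qs \<Longrightarrow> sum_list (map f ps) = sum_list (map f qs)"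
  for f :: "'a \<Rightarrow> 'b::comm_monoid_add"
  by (metis mset_map sum_mset_sum_list)

lemma prod_list_mset_cong: "mset ps = mset qs \<Longrightarrow> prod_list (map f ps) = prod_list (map f qs)"
  for f :: "'a \<Rightarrow> 'b::comm_monoid_mult"
  by (metis mset_map prod_mset_prod_list)

lemma mset_concat_map_cong: "mset ps = mset qs \<Longrightarrow> mset (concat (map F ps)) = mset (concat (map F qs))"
  using sum_list_mset_cong[of ps qs "\<lambda>p. mset (F p)"] by (simp add: mset_concat o_def)

lemma presents_permute:
  assumes "mset ps = mset qs" "presents E inc f ps"
  shows "presents E inc f qs"
proof -
  have set: "set ps = set qs" and length: "length ps = length qs"
    using assms(1) mset_eq_setD mset_eq_length by blast+
  have core: "core qs = core ps" by (simp add: core_def set)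
  have ends: "ends qs = ends ps"
    by (simp add: ends_def fun_eq_iff sum_list_mset_cong[OF assms(1)])
  have matrix: "route_matrix u qs = route_matrix u ps" for u
    by (simp add: route_matrix_def sum_list_mset_cong[OF assms(1)])
  have zeta: "route_zeta qs = route_zeta ps"
    by (simp add: route_zeta_def fun_eq_iff matrix prod_list_mset_cong[OF assms(1)])
  have concat: "distinct (concat (map mids qs)) = distinct (concat (map mids ps))"
      "distinct (concat (map edges qs)) = distinct (concat (map edges ps))"
      "set (concat (map edges qs)) = set (concat (map edges ps))"
    by (metis mset_concat_map_cong[OF assms(1)] mset_eq_imp_distinct_iff mset_eq_setD)+
  show ?thesis
    using assms(2) unfolding presents_def route_decomp_def route_connected_def
      core ends zeta concat set[symmetric] length[symmetric] .
qed

definition flip :: "('v, 'e) route \<Rightarrow> ('v, 'e) route" where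
  "flip p = Route (tgt p) (rev (mids p)) (src p) (rev (edges p))"

lemma flip_sel [simp]:
  "src (flip p) = tgt p" "tgt (flip p) = src p"
  "mids (flip p) = rev (mids p)" "edges (flip p) = rev (edges p)"
  by (simp_all add: flip_def)

lemma is_route_flip: "is_route inc p \<Longrightarrow> is_route inc (flip p)"
  unfolding is_route_def using links_rev[of "src p # mids p @ [tgt p]"] by (simp flip: rev_map)

lemma weight_flip [simp]: "weight u (flip p) i j = weight u p i j"
  by (auto simp: weight_def Let_def add_ac)

lemma list_all2_in_set: "list_all2 P xs ys \<Longrightarrow> y \<in> set ys \<Longrightarrow> \<exists>x\<in>set xs. P x y"
  by (induction xs ys rule: list_all2_induct) auto

lemma presents_reorient:
  assumes or: "list_all2 (\<lambda>p q. q = p \<or> q = flip p) ps qs" and pres: "presents E inc f ps"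
  shows "presents E inc f qs"
proof -
  have ms: "mset (concat (map mids qs)) = mset (concat (map mids ps))"
    and es: "mset (concat (map edges qs)) = mset (concat (map edges ps))"
    using or by (induction ps qs rule: list_all2_induct) auto
  have core: "core qs = core ps"
    using mset_eq_setD[OF ms] by (simp add: core_def)
  have ends: "ends qs v = ends ps v" for v
    using or unfolding ends_def
    by (induction ps qs rule: list_all2_induct) (simp, elim disjE, simp_all add: add.commute)
  have "(\<Sum>p\<leftarrow>qs. weight u p i j) = (\<Sum>p\<leftarrow>ps. weight u p i j)" for u i j
    using or by (induction ps qs rule: list_all2_induct) auto
  then have "route_matrix u qs = route_matrix u ps" for u
    by (simp add: route_matrix_def)
  moreover have "(\<Prod>p\<leftarrow>qs. 1 - (u ^ length (edges p))\<^sup>2) = (\<Prod>p\<leftarrow>ps. 1 - (u ^ length (edges p))\<^sup>2)"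
    for u :: real
    using or by (induction ps qs rule: list_all2_induct) auto
  ultimately have zeta: "route_zeta qs u = route_zeta ps u" for u
    by (simp add: route_zeta_def)
  have routes: "\<forall>p\<in>set qs. {src p, tgt p} \<subseteq> C \<and> is_route inc p"
    if C: "\<forall>p\<in>set ps. {src p, tgt p} \<subseteq> C \<and> is_route inc p" for C
  proof
    fix q assume "q \<in> set qs"
    then obtain p where "p \<in> set ps" "q = p \<or> q = flip p"
      using list_all2_in_set[OF or] by blast
    then show "{src q, tgt q} \<subseteq> C \<and> is_route inc q"
      using C is_route_flip by (elim disjE) auto
  qed
  have closed: "(\<forall>p\<in>set qs. src p \<in> S \<longleftrightarrow> tgt p \<in> S) = (\<forall>p\<in>set ps. src p \<in> S \<longleftrightarrow> tgt p \<in> S)" for S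
    using or by (induction ps qs rule: list_all2_induct) (simp, elim disjE, auto)
  have len: "length qs = length ps"
    using list_all2_lengthD[OF or] by simp
  have concat: "distinct (concat (map mids qs)) = distinct (concat (map mids ps))"
      "distinct (concat (map edges qs)) = distinct (concat (map edges ps))"
      "set (concat (map edges qs)) = set (concat (map edges ps))"
    by (rule mset_eq_imp_distinct_iff[OF ms] mset_eq_imp_distinct_iff[OF es] mset_eq_setD[OF es])+
  show ?thesis
    using pres routes unfolding presents_def route_decomp_def route_connected_def
      core ends zeta closed len concat by (elim conjE) (intro conjI; assumption?)
qed

section \<open>Joining two routes at a vertex of degree two\<close>

definition merge :: "('v, 'e) route \<Rightarrow> ('v, 'e) route \<Rightarrow> ('v, 'e) route" where
  "merge p q = Route (src p) (mids p @ src q # mids q) (tgt q) (edges p @ edges q)"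

lemma merge_sel [simp]:
  "src (merge p q) = src p" "tgt (merge p q) = tgt q"
  "mids (merge p q) = mids p @ src q # mids q" "edges (merge p q) = edges p @ edges q"
  by (simp_all add: merge_def)

lemma is_route_merge:
  assumes "is_route inc p" "is_route inc q" "tgt p = src q"
  shows "is_route inc (merge p q)"
  using assms links_append[of "src p # mids p" "src q" "mids q @ [tgt q]"]
  by (simp add: is_route_def)

lemma weight_eq_0: "v \<noteq> src p \<Longrightarrow> v \<noteq> tgt p \<Longrightarrow> weight u p v j = 0 \<and> weight u p j v = 0"
  by (auto simp: weight_def Let_def)

text \<open>Pivoting at \<open>v\<close> turns the entries of two routes of weights \<open>s\<close>
  and \<open>t\<close> into those of one route of weight \<open>s * t\<close>. The pivot
  \<open>m\<close> changes the factors \<open>1 - s\<^sup>2\<close> and \<open>1 - t\<^sup>2\<close>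
  into \<open>1 - (s * t)\<^sup>2\<close>.\<close>

lemma route_zeta_merge:
  assumes v: "tgt p = v" "src q = v" "src p \<noteq> v" "tgt q \<noteq> v"
    and rs: "\<And>r. r \<in> set rs \<Longrightarrow> src r \<noteq> v \<and> tgt r \<noteq> v"
    and pos: "edges p \<noteq> []" "edges q \<noteq> []" and u: "0 < u" "u < 1"
  shows "route_zeta (merge p q # rs) u = route_zeta (p # q # rs) u"
proof -
  define s where "s = u ^ length (edges p)"
  define t where "t = u ^ length (edges q)"
  \<comment> \<open>The negated off-diagonal weights of \<open>p\<close>, \<open>q\<close> and the
    merged route; the diagonal ones are \<open>s * \<alpha>\<close>, \<open>t * \<beta>\<close> and
    \<open>s * t * \<gamma>\<close>.\<close>
  define \<alpha> where "\<alpha> = s / (1 - s\<^sup>2)"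
  define \<beta> where "\<beta> = t / (1 - t\<^sup>2)"
  define \<gamma> where "\<gamma> = s * t / (1 - (s * t)\<^sup>2)"
  define m where "m = 1 + s * \<alpha> + t * \<beta>"
  have "0 < s" "s < 1" "0 < t" "t < 1"
    using u pos by (auto simp: s_def t_def power_less_one_iff)
  moreover from this have "s * t < 1 * 1" by (intro mult_strict_mono) auto
  ultimately have s: "0 < s" "s\<^sup>2 < 1" and t: "0 < t" "t\<^sup>2 < 1" and st: "(s * t)\<^sup>2 < 1"
    by (simp_all add: abs_square_less_1)
  have m: "m = (1 - (s * t)\<^sup>2) / ((1 - s\<^sup>2) * (1 - t\<^sup>2))"
    using s t by (simp add: m_def \<alpha>_def \<beta>_def divide_simps power2_eq_square) (simp add: algebra_simps)
  then have "m > 0" using s t st by simp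
  \<comment> \<open>The three corrections of the Schur complement: the first is the new off-diagonal
    entry, the other two reduce the old diagonal weights to \<open>s * t * \<gamma>\<close>.\<close>
  have \<alpha>\<beta>: "\<alpha> * \<beta> / m = \<gamma>"
    using s t st by (simp add: m \<alpha>_def \<beta>_def \<gamma>_def)
  have \<alpha>\<alpha>: "\<alpha> * \<alpha> / m = s * \<alpha> - s * t * \<gamma>"
    using s t st by (simp add: m \<alpha>_def \<gamma>_def divide_simps) (simp add: algebra_simps power2_eq_square)
  have \<beta>\<beta>: "\<beta> * \<beta> / m = t * \<beta> - s * t * \<gamma>"
    using s t st by (simp add: m \<beta>_def \<gamma>_def divide_simps) (simp add: algebra_simps power2_eq_square)
  let ?A = "route_matrix u (p # q # rs)" and ?B = "route_matrix u (merge p q # rs)"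
  have "weight u r v j = 0" "weight u r j v = 0" if "r \<in> set rs" for r j
    using rs[OF that] weight_eq_0[of v r] by auto
  then have rs0: "(\<Sum>r\<leftarrow>rs. weight u r v j) = 0" "(\<Sum>r\<leftarrow>rs. weight u r j v) = 0" for j
    by (simp_all cong: map_cong)
  have wp: "weight u p i j = of_bool (i = j) * (of_bool (i = src p) + of_bool (i = v)) * (s * \<alpha>)
      - (of_bool (i = src p \<and> j = v) + of_bool (i = v \<and> j = src p)) * \<alpha>" for i j
    by (simp add: weight_def Let_def \<alpha>_def v power2_eq_square flip: s_def)
  have wq: "weight u q i j = of_bool (i = j) * (of_bool (i = v) + of_bool (i = tgt q)) * (t * \<beta>)
      - (of_bool (i = v \<and> j = tgt q) + of_bool (i = tgt q \<and> j = v)) * \<beta>" for i j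
    by (simp add: weight_def Let_def \<beta>_def v power2_eq_square flip: t_def)
  have wm: "weight u (merge p q) i j =
      of_bool (i = j) * (of_bool (i = src p) + of_bool (i = tgt q)) * (s * t * \<gamma>)
      - (of_bool (i = src p \<and> j = tgt q) + of_bool (i = tgt q \<and> j = src p)) * \<gamma>" for i j
    by (simp add: weight_def Let_def \<gamma>_def power_add power2_eq_square flip: s_def t_def)
  have Avv: "?A $ v $ v = m"
    using v by (simp add: route_matrix_def rs0 wp wq m_def)
  have Aiv: "?A $ i $ v = - (of_bool (i = src p) * \<alpha> + of_bool (i = tgt q) * \<beta>)"
    and Avi: "?A $ v $ i = - (of_bool (i = src p) * \<alpha> + of_bool (i = tgt q) * \<beta>)" if "i \<noteq> v" for i
    using v that by (simp_all add: route_matrix_def rs0 wp wq)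
  have "(if i = v \<or> j = v then of_bool (i = j)
      else ?A $ i $ j - ?A $ i $ v * ?A $ v $ j / ?A $ v $ v) = ?B $ i $ j" for i j
  proof (cases "i = v \<or> j = v")
    case True
    moreover have "weight u (merge p q) v j = 0" "weight u (merge p q) i v = 0"
      using weight_eq_0[of v "merge p q"] v(3,4) by simp_all
    ultimately show ?thesis
      by (elim disjE) (simp_all add: route_matrix_def rs0)
  next
    case False
    \<comment> \<open>The indicators are multiplied out for arbitrary ends, so the case
      \<open>src p = tgt q\<close>, where merging creates a loop, is included.\<close>
    have "?A $ i $ v * ?A $ v $ j / m =
        of_bool (i = src p \<and> j = src p) * (\<alpha> * \<alpha> / m) + of_bool (i = tgt q \<and> j = tgt q) * (\<beta> * \<beta> / m)
        + (of_bool (i = src p \<and> j = tgt q) + of_bool (i = tgt q \<and> j = src p)) * (\<alpha> * \<beta> / m)"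
      using False \<open>m > 0\<close> by (simp add: Aiv Avi field_simps)
    then have *: "?A $ i $ v * ?A $ v $ j / ?A $ v $ v =
        of_bool (i = src p \<and> j = src p) * (s * \<alpha> - s * t * \<gamma>)
        + of_bool (i = tgt q \<and> j = tgt q) * (t * \<beta> - s * t * \<gamma>)
        + (of_bool (i = src p \<and> j = tgt q) + of_bool (i = tgt q \<and> j = src p)) * \<gamma>"
      by (simp only: Avv \<alpha>\<alpha> \<beta>\<beta> \<alpha>\<beta>)
    show ?thesis
      unfolding * using False by (auto simp: route_matrix_def wp wq wm algebra_simps)
  qed
  then have "det ?A = m * det ?B"
    using det_schur_pivot[of ?A v] \<open>m > 0\<close> by (simp add: Avv)
  moreover have "(1 - s\<^sup>2) * (1 - t\<^sup>2) * m = 1 - (s * t)\<^sup>2"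
    using s t by (simp add: m)
  ultimately show ?thesis
    by (simp add: route_zeta_def power_add flip: s_def t_def)
qed

lemma core_merge: "core (merge p q # rs) = core (p # q # rs) - {src q}"
  by (auto simp: core_def)

text \<open>The list of routes and the core each lose one element, so the rank stays two, and the
  degrees of the other core vertices do not change.\<close>

lemma presents_merge:
  assumes pres: "presents E inc f (p # q # rs)"
    and v: "tgt p = v" "src q = v" "src p \<noteq> v" "tgt q \<noteq> v"
    and rs: "\<And>r. r \<in> set rs \<Longrightarrow> src r \<noteq> v \<and> tgt r \<noteq> v"
  shows "presents E inc f (merge p q # rs)"
proof -
  let ?ps = "p # q # rs" and ?qs = "merge p q # rs"
  have dec: "route_decomp E inc ?ps" and conn: "route_connected ?ps"
    using pres by (simp_all add: presents_def)
  have core: "core ?qs = core ?ps - {v}"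
    using core_merge v(2) by metis
  have vc: "v \<in> core ?ps"
    using dec v by (auto simp: route_decomp_def)
  then have v_notin: "v \<notin> set (mids p)" "v \<notin> set (mids q)" "\<forall>r\<in>set rs. v \<notin> set (mids r)"
    by (auto simp: core_def)
  have ends_in: "{src r, tgt r} \<subseteq> core ?ps" "is_route inc r" if "r \<in> set ?ps" for r
    using dec that by (auto simp: route_decomp_def)
  have "route_decomp E inc ?qs"
    unfolding route_decomp_def
  proof (intro conjI ballI)
    show "distinct (concat (map mids ?qs))" "distinct (concat (map edges ?qs))"
        "set (concat (map edges ?qs)) = E"
      using dec v v_notin by (auto simp: route_decomp_def)
    show "{src r, tgt r} \<subseteq> core ?qs" if "r \<in> set ?qs" for r
      using that ends_in[of p] ends_in[of q] ends_in[of r] v rs unfolding core by auto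
    show "is_route inc r" if "r \<in> set ?qs" for r
      using that is_route_merge[of inc p q] ends_in(2) v by auto
  qed
  moreover have "route_connected ?qs"
    unfolding route_connected_def
  proof (intro allI impI)
    fix S assume S: "S \<subseteq> core ?qs" "S \<noteq> {}" "\<forall>r\<in>set ?qs. src r \<in> S \<longleftrightarrow> tgt r \<in> S"
    \<comment> \<open>A union of components after merging extends to one before: \<open>v\<close>
      joins it exactly when the ends of the merged route belong to it.\<close>
    define S' where "S' = (if src p \<in> S then insert v S else S)"
    have "v \<notin> S" using S(1) core by auto
    then have "\<forall>r\<in>set ?ps. src r \<in> S' \<longleftrightarrow> tgt r \<in> S'"
      using S(3) v rs by (auto simp: S'_def)
    moreover have "S' \<subseteq> core ?ps" "S' \<noteq> {}"
      using S(1,2) vc core by (auto simp: S'_def)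
    ultimately have "S' = core ?ps"
      using conn unfolding route_connected_def by blast
    then show "S = core ?qs"
      using \<open>v \<notin> S\<close> vc core by (auto simp: S'_def split: if_splits)
  qed
  moreover have "length ?qs = Suc (card (core ?qs))"
    using pres vc card_Suc_Diff1[OF _ vc] by (simp add: presents_def core)
  moreover have "2 \<le> ends ?qs w" if "w \<in> core ?qs" for w
  proof -
    have "ends ?qs w = ends ?ps w"
      using that v core by (auto simp: ends_def)
    then show ?thesis
      using that pres core by (auto simp: presents_def)
  qed
  moreover have "edges r \<noteq> []" if "r \<in> set ?ps" for r
    using length_edges[OF ends_in(2)[OF that]] by auto
  then have "route_zeta ?qs u = route_zeta ?ps u" if "0 < u" "u < 1" for u
    using route_zeta_merge[OF v rs _ _ that] by simp
  ultimately show ?thesis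
    using pres by (simp add: presents_def)
qed

section \<open>Degrees in the contracted graph\<close>

lemma ends_Nil [simp]: "ends [] v = 0"
  and ends_Cons [simp]: "ends (p # ps) v = of_bool (src p = v) + of_bool (tgt p = v) + ends ps v"
  by (simp_all add: ends_def)

lemma ends_mset_cong: "mset ps = mset qs \<Longrightarrow> ends ps v = ends qs v"
  unfolding ends_def by (rule sum_list_mset_cong)

lemma ends_eq_0: "ends ps v = 0 \<Longrightarrow> p \<in> set ps \<Longrightarrow> src p \<noteq> v \<and> tgt p \<noteq> v"
  by (induction ps) (auto split: if_splits)

lemma ends_pos_split:
  assumes "ends ps v > 0"
  obtains p qs where "mset ps = mset (p # qs)" "src p = v \<or> tgt p = v"
proof -
  have "\<exists>p\<in>set ps. src p = v \<or> tgt p = v"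
    using assms by (induction ps) (auto split: if_splits)
  then obtain p where "p \<in> set ps" "src p = v \<or> tgt p = v" by blast
  then show thesis using that[of p "remove1 p ps"] by simp
qed

text \<open>The handshake identity; a loop contributes both of its ends at one vertex.\<close>

lemma sum_ends:
  assumes "finite C" "\<And>p. p \<in> set ps \<Longrightarrow> src p \<in> C \<and> tgt p \<in> C"
  shows "(\<Sum>v\<in>C. ends ps v) = 2 * length ps"
  using assms(2)
proof (induction ps)
  case (Cons p ps)
  have "(\<Sum>v\<in>C. of_bool (w = v)) = (1::nat)" if "w \<in> C" for w
    using assms(1) that by (simp add: of_bool_def)
  then show ?case
    using Cons by (simp add: sum.distrib)
qed simp

lemma presents_ends_in_core:
  "presents E inc f ps \<Longrightarrow> p \<in> set ps \<Longrightarrow> src p \<in> core ps \<and> tgt p \<in> core ps"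
  by (auto simp: presents_def route_decomp_def)

lemma presents_edges_nonempty: "presents E inc f ps \<Longrightarrow> p \<in> set ps \<Longrightarrow> edges p \<noteq> []"
  using length_edges[of inc p] by (auto simp: presents_def route_decomp_def)

text \<open>Connectedness excludes a loop at \<open>v\<close>: it would be a whole component, of rank one.\<close>

lemma presents_eliminate:
  assumes pres: "presents E inc f ps" and v: "v \<in> core ps" "ends ps v = 2"
  shows "\<exists>qs. presents E inc f qs \<and> length qs < length ps"
proof -
  obtain p ps' where p: "mset ps = mset (p # ps')" "src p = v \<or> tgt p = v"
    using v ends_pos_split[of ps v] by auto
  have presp: "presents E inc f (p # ps')" and corep: "v \<in> core (p # ps')"
    using presents_permute[OF p(1) pres] v(1) mset_eq_setD[OF p(1)] by (simp_all add: core_def)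
  have not_loop: "src p \<noteq> tgt p"
  proof
    assume loop: "src p = tgt p"
    then have "ends ps' v = 0"
      using v(2) p ends_mset_cong[OF p(1), of v] by auto
    note off = ends_eq_0[OF this]
    have "route_connected (p # ps')" using presp by (simp add: presents_def)
    moreover have "\<forall>r\<in>set (p # ps'). src r \<in> {v} \<longleftrightarrow> tgt r \<in> {v}"
      using off loop by auto
    ultimately have "{v} = core (p # ps')"
      using corep unfolding route_connected_def by blast
    moreover have "length (p # ps') = Suc (card (core (p # ps')))"
      using presp by (simp add: presents_def)
    \<comment> \<open>Rank two forces a second route besides the loop; its ends would have to be at
      \<open>v\<close>, whose degree the loop has used up.\<close>
    ultimately have "length ps' = 1"
      by (metis card_1_singleton_iff Suc_inject length_Cons One_nat_def)
    then obtain q where "q \<in> set ps'" by (cases ps') auto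
    then have "src q = v"
      using presents_ends_in_core[OF presp, of q] \<open>{v} = core (p # ps')\<close> by auto
    then show False using off \<open>q \<in> set ps'\<close> by blast
  qed
  then have "ends ps' v = 1"
    using v(2) p ends_mset_cong[OF p(1), of v] by auto
  then obtain q rs where q: "mset ps' = mset (q # rs)" "src q = v \<or> tgt q = v"
    using ends_pos_split[of ps' v] by auto
  have "ends (q # rs) v = 1"
    using \<open>ends ps' v = 1\<close> ends_mset_cong[OF q(1)] by simp
  with q(2) have q_not_loop: "src q \<noteq> tgt q" and rs: "ends rs v = 0"
    by auto
  have presq: "presents E inc f (p # q # rs)"
    by (rule presents_permute[OF _ presp]) (simp add: q(1))
  \<comment> \<open>Directions are chosen so that \<open>p'\<close> enters \<open>v\<close> and
    \<open>q'\<close> leaves it.\<close>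
  define p' where "p' = (if src p = v then flip p else p)"
  define q' where "q' = (if src q = v then q else flip q)"
  have "presents E inc f (p' # q' # rs)"
    by (rule presents_reorient[OF _ presq]) (simp add: p'_def q'_def list.rel_refl)
  moreover have "tgt p' = v" "src q' = v" "src p' \<noteq> v" "tgt q' \<noteq> v"
    using p(2) q(2) not_loop q_not_loop by (auto simp: p'_def q'_def)
  ultimately have "presents E inc f (merge p' q' # rs)"
    using presents_merge ends_eq_0[OF rs] by metis
  moreover have "length ps = Suc (Suc (length rs))"
    using mset_eq_length[OF p(1)] mset_eq_length[OF q(1)] by simp
  ultimately show ?thesis by (intro exI[of _ "merge p' q' # rs"]) simp
qed

section \<open>The three shapes\<close>

lemma presents_reduce:
  assumes "presents E inc f ps"
  shows "\<exists>qs. presents E inc f qs \<and> (\<forall>v\<in>core qs. 3 \<le> ends qs v)"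
  using assms
proof (induction "length ps" arbitrary: ps rule: less_induct)
  case less
  show ?case
  proof (cases "\<exists>v\<in>core ps. ends ps v = 2")
    case True
    then show ?thesis
      using presents_eliminate[OF less.prems] less.hyps by blast
  next
    case False
    then have "\<forall>v\<in>core ps. 3 \<le> ends ps v"
      using less.prems by (force simp: presents_def)
    then show ?thesis using less.prems by blast
  qed
qed

text \<open>The lengths are parameters because the zeta function has to determine them, the core
  vertices because an isomorphism has to match them.\<close>

definition figure_eight ::
  "'e set \<Rightarrow> ('e \<Rightarrow> 'v multiset) \<Rightarrow> (real \<Rightarrow> real) \<Rightarrow> nat \<Rightarrow> nat \<Rightarrow> ('v::finite) \<Rightarrow> bool" where
  "figure_eight E inc f a b s \<longleftrightarrow> (\<exists>p q. presents E inc f [p, q] \<and> core [p, q] = {s} \<and>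
     src p = s \<and> tgt p = s \<and> src q = s \<and> tgt q = s \<and>
     length (edges p) = a \<and> length (edges q) = b)"

definition dumbbell ::
  "'e set \<Rightarrow> ('e \<Rightarrow> 'v multiset) \<Rightarrow> (real \<Rightarrow> real) \<Rightarrow> nat \<Rightarrow> nat \<Rightarrow> nat \<Rightarrow> ('v::finite) \<Rightarrow> 'v \<Rightarrow> bool" where
  "dumbbell E inc f a b c s t \<longleftrightarrow> s \<noteq> t \<and> (\<exists>p q r. presents E inc f [p, q, r] \<and> core [p, q, r] = {s, t} \<and>
     src p = s \<and> tgt p = s \<and> src q = t \<and> tgt q = t \<and> src r = s \<and> tgt r = t \<and>
     length (edges p) = a \<and> length (edges q) = b \<and> length (edges r) = c)"

definition theta ::
  "'e set \<Rightarrow> ('e \<Rightarrow> 'v multiset) \<Rightarrow> (real \<Rightarrow> real) \<Rightarrow> nat \<Rightarrow> nat \<Rightarrow> nat \<Rightarrow> ('v::finite) \<Rightarrow> 'v \<Rightarrow> bool" where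
  "theta E inc f a b c s t \<longleftrightarrow> s \<noteq> t \<and> (\<exists>p q r. presents E inc f [p, q, r] \<and> core [p, q, r] = {s, t} \<and>
     src p = s \<and> tgt p = t \<and> src q = s \<and> tgt q = t \<and> src r = s \<and> tgt r = t \<and>
     length (edges p) = a \<and> length (edges q) = b \<and> length (edges r) = c)"

text \<open>With n core vertices there are n + 1 routes, so the degree sum is 2 (n + 1). If all
  degrees are at least 3, it is at least 3 n, whence n is at most 2.\<close>

lemma presents_card_core_le_2:
  assumes pres: "presents E inc f ps" and deg: "\<forall>v\<in>core ps. 3 \<le> ends ps v"
  shows "card (core ps) = 1 \<or> card (core ps) = 2"
proof -
  have len: "length ps = Suc (card (core ps))"
    using pres by (simp add: presents_def)
  have "(\<Sum>v\<in>core ps. 3) \<le> (\<Sum>v\<in>core ps. ends ps v)"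
    using deg by (intro sum_mono) auto
  also have "\<dots> = 2 * length ps"
    using presents_ends_in_core[OF pres] by (intro sum_ends) auto
  finally have "card (core ps) \<le> 2" using len by simp
  moreover have "core ps \<noteq> {}"
    using len presents_ends_in_core[OF pres, of "hd ps"] by (cases ps) auto
  then have "card (core ps) \<noteq> 0" by simp
  ultimately show ?thesis by linarith
qed

text \<open>One core vertex carries two loops. With two core vertices there are three routes: if
  none is a loop, all of them join the two vertices; if one is, counting degrees yields a
  dumbbell.\<close>

lemma presents_classify:
  assumes pres: "presents E inc f ps" and deg: "\<forall>v\<in>core ps. 3 \<le> ends ps v"
  shows "(\<exists>a b s. figure_eight E inc f a b s) \<or> (\<exists>a b c s t. dumbbell E inc f a b c s t)
       \<or> (\<exists>a b c s t. theta E inc f a b c s t)"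
  using presents_card_core_le_2[OF assms]
proof
  assume "card (core ps) = 1"
  moreover from this obtain s where s: "core ps = {s}" by (auto simp: card_1_singleton_iff)
  ultimately have "length ps = 2" using pres by (simp add: presents_def)
  then obtain p q where ps: "ps = [p, q]"
    by (auto simp: numeral_2_eq_2 length_Suc_conv)
  have "figure_eight E inc f (length (edges p)) (length (edges q)) s"
    using pres s presents_ends_in_core[OF pres] unfolding figure_eight_def ps
    by (intro exI[of _ p] exI[of _ q]) auto
  then show ?thesis by blast
next
  assume card: "card (core ps) = 2"
  then have len: "length ps = 3" using pres by (simp add: presents_def)
  show ?thesis
  proof (cases "\<exists>p\<in>set ps. src p = tgt p")
    case True
    then obtain p where p: "p \<in> set ps" "src p = tgt p" by blast
    then have "src p \<in> core ps" using presents_ends_in_core[OF pres] by blast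
    with card obtain s t where st: "core ps = {s, t}" "s \<noteq> t" "src p = s" "tgt p = s"
      using p(2) unfolding card_2_iff by force
    have "mset ps = mset (p # remove1 p ps)" using p(1) by simp
    moreover from p(1) len have "length (remove1 p ps) = 2" by (simp add: length_remove1)
    then obtain q r where "remove1 p ps = [q, r]"
      by (auto simp: numeral_2_eq_2 length_Suc_conv)
    ultimately have perm: "mset ps = mset [p, q, r]" by simp
    have in_core: "src x \<in> {s, t} \<and> tgt x \<in> {s, t}" if "x \<in> {p, q, r}" for x
      using presents_ends_in_core[OF pres, of x] that mset_eq_setD[OF perm] st(1) by simp
    \<comment> \<open>Both degrees are exactly 3. The loop \<open>p\<close> takes two ends at
      \<open>s\<close>, so the other two routes share one end at \<open>s\<close> and three at
      \<open>t\<close>: a loop at \<open>t\<close> and a bridge, in either order.\<close>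
    have "(\<Sum>v\<in>{s, t}. ends ps v) = 6"
      using sum_ends[of "core ps" ps] presents_ends_in_core[OF pres] len st(1) by simp
    moreover have "3 \<le> ends ps s" "3 \<le> ends ps t" using deg st(1) by auto
    ultimately have "ends ps s = 3" "ends ps t = 3" using st(2) by simp_all
    then have ends: "ends [p, q, r] s = 3" "ends [p, q, r] t = 3"
      using ends_mset_cong[OF perm] by metis+
    have "\<exists>q r. mset ps = mset [p, q, r] \<and> src q = t \<and> tgt q = t \<and> {src r, tgt r} = {s, t}"
    proof (cases "src q = t \<and> tgt q = t")
      case True
      then show ?thesis
        using perm ends in_core[of r] st by (intro exI[of _ q] exI[of _ r]) (auto split: if_splits)
    next
      case False
      then have "src r = t \<and> tgt r = t \<and> {src q, tgt q} = {s, t}"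
        using ends in_core[of r] in_core[of q] st by (auto split: if_splits)
      then show ?thesis
        using perm by (intro exI[of _ r] exI[of _ q]) (auto simp: add_mset_commute)
    qed
    then obtain q r where qr: "mset ps = mset [p, q, r]" "src q = t" "tgt q = t" "{src r, tgt r} = {s, t}"
      by blast
    define r' where "r' = (if src r = s then r else flip r)"
    have "presents E inc f [p, q, r']"
      by (rule presents_reorient[OF _ presents_permute[OF qr(1) pres]]) (simp add: r'_def)
    moreover have "core [p, q, r'] = {s, t}"
      using mset_eq_setD[OF qr(1)] st(1) by (simp add: core_def r'_def)
    moreover have "src r' = s" "tgt r' = t"
      using qr(4) st(2) by (auto simp: r'_def doubleton_eq_iff)
    ultimately have "dumbbell E inc f (length (edges p)) (length (edges q)) (length (edges r')) s t"
      using st qr unfolding dumbbell_def by blast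
    then show ?thesis by blast
  next
    case False
    obtain s t where st: "core ps = {s, t}" "s \<noteq> t"
      using card by (auto simp: card_2_iff)
    define qs where "qs = map (\<lambda>p. if src p = s then p else flip p) ps"
    have pres': "presents E inc f qs"
      by (rule presents_reorient[OF _ pres]) (simp add: qs_def list.rel_map list.rel_refl)
    have "core qs = core ps" by (auto simp: core_def qs_def split: if_splits)
    moreover have "src x = s \<and> tgt x = t" if x: "x \<in> set qs" for x
    proof -
      obtain p where p: "p \<in> set ps" "x = (if src p = s then p else flip p)"
        using x by (auto simp: qs_def)
      then have "src p \<in> {s, t}" "tgt p \<in> {s, t}" "src p \<noteq> tgt p"
        using presents_ends_in_core[OF pres, of p] st False by auto
      then show ?thesis using p(2) by auto
    qed
    moreover obtain p q r where qs: "qs = [p, q, r]"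
      using len by (auto simp: qs_def numeral_3_eq_3 length_Suc_conv)
    ultimately have "core [p, q, r] = {s, t}" "src p = s" "tgt p = t" "src q = s" "tgt q = t"
        "src r = s" "tgt r = t"
      using st by simp_all
    then have "theta E inc f (length (edges p)) (length (edges q)) (length (edges r)) s t"
      using pres'[unfolded qs] st(2) unfolding theta_def by blast
    then show ?thesis by blast
  qed
qed

section \<open>Zeta functions of the three shapes\<close>

lemma route_zeta_eqI:
  assumes "presents E inc f ps" "0 < u" "u < 1"
  shows "f u = route_zeta ps u"
  using assms by (simp add: presents_def)

text \<open>Reduces the determinants below to size 1 or 2, the size of the core.\<close>

lemma route_matrix_unit:
  assumes "\<And>p. p \<in> set ps \<Longrightarrow> {src p, tgt p} \<subseteq> C" and "i \<notin> C \<or> j \<notin> C"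
  shows "route_matrix u ps $ i $ j = of_bool (i = j)"
proof -
  have "weight u p i j = 0" if "p \<in> set ps" for p
    using assms(1)[OF that] assms(2) weight_eq_0[of i p u j] weight_eq_0[of j p u i] by blast
  then have "(\<Sum>p\<leftarrow>ps. weight u p i j) = 0"
    by (simp cong: map_cong)
  then show ?thesis by (simp add: route_matrix_def)
qed

lemma figure_eight_zeta:
  assumes fe: "figure_eight E inc f a b s"
  shows "0 < a" "0 < b" "\<And>u. 0 < u \<Longrightarrow> u < 1 \<Longrightarrow> f u = dumbbell_poly a b 0 u"
proof -
  obtain p q where pres: "presents E inc f [p, q]"
    and ends: "src p = s" "tgt p = s" "src q = s" "tgt q = s"
    and len: "length (edges p) = a" "length (edges q) = b"
    using fe by (auto simp: figure_eight_def)
  show a: "0 < a" and b: "0 < b"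
    using presents_edges_nonempty[OF pres] len by auto
  fix u :: real assume u: "0 < u" "u < 1"
  define x y where xy: "x = u ^ a" "y = u ^ b"
  have "0 < x" "x < 1" "0 < y" "y < 1"
    using u a b by (auto simp: xy power_less_one_iff)
  then have sq: "x\<^sup>2 < 1" "y\<^sup>2 < 1" by (simp_all add: abs_square_less_1)
  let ?M = "route_matrix u [p, q]"
  have "det ?M = ?M $ s $ s"
  proof (rule det_unit_outside_point)
    show "?M $ i $ j = of_bool (i = j)" if "i \<noteq> s \<or> j \<noteq> s" for i j
      using that ends by (intro route_matrix_unit[where C = "{s}"]) auto
  qed
  also have "\<dots> = 1 + (2 * x\<^sup>2 - 2 * x) / (1 - x\<^sup>2) + (2 * y\<^sup>2 - 2 * y) / (1 - y\<^sup>2)"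
    by (simp add: route_matrix_def weight_def ends len Let_def diff_divide_distrib flip: xy)
  also have "(1 - x\<^sup>2) * (1 - y\<^sup>2) * \<dots> =
      (1 - x\<^sup>2) * (1 - y\<^sup>2) + (2 * x\<^sup>2 - 2 * x) * (1 - y\<^sup>2) + (2 * y\<^sup>2 - 2 * y) * (1 - x\<^sup>2)"
    using sq by (simp add: divide_simps) (simp add: algebra_simps)
  also have "\<dots> = dumbbell_poly a b 0 u"
    by (simp add: dumbbell_poly_def Let_def power2_eq_square algebra_simps flip: xy)
  finally show "f u = dumbbell_poly a b 0 u"
    using route_zeta_eqI[OF pres u] by (simp add: route_zeta_def len flip: xy)
qed

lemma dumbbell_zeta:
  assumes db: "dumbbell E inc f a b c s t"
  shows "0 < a" "0 < b" "0 < c" "\<And>u. 0 < u \<Longrightarrow> u < 1 \<Longrightarrow> f u = dumbbell_poly a b c u"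
proof -
  obtain p q r where pres: "presents E inc f [p, q, r]" and st: "s \<noteq> t"
    and ends: "src p = s" "tgt p = s" "src q = t" "tgt q = t" "src r = s" "tgt r = t"
    and len: "length (edges p) = a" "length (edges q) = b" "length (edges r) = c"
    using db by (auto simp: dumbbell_def)
  show a: "0 < a" and b: "0 < b" and c: "0 < c"
    using presents_edges_nonempty[OF pres] len by auto
  fix u :: real assume u: "0 < u" "u < 1"
  define x y z where xyz: "x = u ^ a" "y = u ^ b" "z = u ^ c"
  have pos: "0 < x" "x < 1" "0 < y" "y < 1" "0 < z" "z < 1"
    using u a b c by (auto simp: xyz power_less_one_iff)
  then have sq: "x\<^sup>2 < 1" "y\<^sup>2 < 1" "z\<^sup>2 < 1" by (simp_all add: abs_square_less_1)
  let ?M = "route_matrix u [p, q, r]"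
  \<comment> \<open>Numerators of the diagonal entries over the denominators in \<open>Mss\<close>
    and \<open>Mtt\<close>; the factored form shows that the pivot is nonzero.\<close>
  define P Q where "P = (1 - x) * (1 - x + 2 * x * z\<^sup>2)" "Q = (1 - y) * (1 - y + 2 * y * z\<^sup>2)"
  have Mss: "?M $ s $ s = P / ((1 - x\<^sup>2) * (1 - z\<^sup>2))"
    using sq st by (simp add: route_matrix_def weight_def ends len Let_def P_Q_def divide_simps flip: xyz)
      (simp add: power2_eq_square algebra_simps)
  have Mtt: "?M $ t $ t = Q / ((1 - y\<^sup>2) * (1 - z\<^sup>2))"
    using sq st by (simp add: route_matrix_def weight_def ends len Let_def P_Q_def divide_simps flip: xyz)
      (simp add: power2_eq_square algebra_simps)
  have Mst: "?M $ s $ t = - z / (1 - z\<^sup>2)" "?M $ t $ s = - z / (1 - z\<^sup>2)"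
    using st by (simp_all add: route_matrix_def weight_def ends len Let_def flip: xyz)
  have "det ?M = ?M $ s $ s * ?M $ t $ t - ?M $ s $ t * ?M $ t $ s"
  proof (rule det_unit_outside_pair[OF st])
    have "0 < Q" using pos by (auto simp: P_Q_def intro!: mult_pos_pos add_pos_pos)
    then show "?M $ t $ t \<noteq> 0" using sq by (simp add: Mtt)
    show "?M $ i $ j = of_bool (i = j)" if "i \<notin> {s, t} \<or> j \<notin> {s, t}" for i j
      using that ends by (intro route_matrix_unit[where C = "{s, t}"]) auto
  qed
  then have "(1 - x\<^sup>2) * (1 - y\<^sup>2) * (1 - z\<^sup>2) * det ?M =
      (P * Q - z\<^sup>2 * ((1 - x\<^sup>2) * (1 - y\<^sup>2))) / (1 - z\<^sup>2)"
    using sq by (simp add: Mss Mtt Mst divide_simps) (simp add: power2_eq_square algebra_simps)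
  \<comment> \<open>The numerator is divisible by \<open>1 - z\<^sup>2\<close>, which cancels the
    denominator left over.\<close>
  also have "P * Q - z\<^sup>2 * ((1 - x\<^sup>2) * (1 - y\<^sup>2)) = (1 - z\<^sup>2) * dumbbell_poly a b c u"
    by (simp add: dumbbell_poly_def Let_def P_Q_def power2_eq_square algebra_simps flip: xyz)
  finally show "f u = dumbbell_poly a b c u"
    using route_zeta_eqI[OF pres u] sq by (simp add: route_zeta_def len mult_ac flip: xyz)
qed

text \<open>The two core vertices play symmetric roles: the diagonal entries are both
  \<open>S\<close>, the others both \<open>- T\<close>, so the determinant splits as
  \<open>(S - T) * (S + T)\<close>.\<close>

lemma theta_zeta:
  assumes th: "theta E inc f a b c s t"
  shows "0 < a" "0 < b" "0 < c" "\<And>u. 0 < u \<Longrightarrow> u < 1 \<Longrightarrow> f u = theta_poly a b c u"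
proof -
  obtain p q r where pres: "presents E inc f [p, q, r]" and st: "s \<noteq> t"
    and ends: "src p = s" "tgt p = t" "src q = s" "tgt q = t" "src r = s" "tgt r = t"
    and len: "length (edges p) = a" "length (edges q) = b" "length (edges r) = c"
    using th by (auto simp: theta_def)
  show a: "0 < a" and b: "0 < b" and c: "0 < c"
    using presents_edges_nonempty[OF pres] len by auto
  fix u :: real assume u: "0 < u" "u < 1"
  define x y z where xyz: "x = u ^ a" "y = u ^ b" "z = u ^ c"
  have pos: "0 < x" "x < 1" "0 < y" "y < 1" "0 < z" "z < 1"
    using u a b c by (auto simp: xyz power_less_one_iff)
  then have sq: "x\<^sup>2 < 1" "y\<^sup>2 < 1" "z\<^sup>2 < 1" by (simp_all add: abs_square_less_1)
  let ?M = "route_matrix u [p, q, r]"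
  define S T where "S = 1 + x\<^sup>2 / (1 - x\<^sup>2) + y\<^sup>2 / (1 - y\<^sup>2) + z\<^sup>2 / (1 - z\<^sup>2)"
    "T = x / (1 - x\<^sup>2) + y / (1 - y\<^sup>2) + z / (1 - z\<^sup>2)"
  have M: "?M $ s $ s = S" "?M $ t $ t = S" "?M $ s $ t = - T" "?M $ t $ s = - T"
    using st by (simp_all add: route_matrix_def weight_def ends len Let_def S_T_def flip: xyz)
  have "det ?M = ?M $ s $ s * ?M $ t $ t - ?M $ s $ t * ?M $ t $ s"
  proof (rule det_unit_outside_pair[OF st])
    have "0 < S" using sq unfolding S_T_def by (intro add_pos_nonneg) auto
    then show "?M $ t $ t \<noteq> 0" by (simp add: M)
    show "?M $ i $ j = of_bool (i = j)" if "i \<notin> {s, t} \<or> j \<notin> {s, t}" for i j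
      using that ends by (intro route_matrix_unit[where C = "{s, t}"]) auto
  qed
  then have det: "det ?M = (S - T) * (S + T)"
    by (simp add: M algebra_simps)
  \<comment> \<open>The denominators split along with the determinant: \<open>S - T\<close> involves
    only the factors \<open>1 + w\<close>, and \<open>S + T\<close> only the factors
    \<open>1 - w\<close>.\<close>
  have minus: "w\<^sup>2 / (1 - w\<^sup>2) - w / (1 - w\<^sup>2) = - (w / (1 + w))"
    and plus: "w\<^sup>2 / (1 - w\<^sup>2) + w / (1 - w\<^sup>2) = w / (1 - w)" if "0 < w" "w < 1" for w :: real
  proof -
    have "1 - w\<^sup>2 = (1 - w) * (1 + w)" by (simp add: power2_eq_square algebra_simps)
    then show "w\<^sup>2 / (1 - w\<^sup>2) - w / (1 - w\<^sup>2) = - (w / (1 + w))"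
      "w\<^sup>2 / (1 - w\<^sup>2) + w / (1 - w\<^sup>2) = w / (1 - w)"
      using that by (simp_all add: divide_simps power2_eq_square) (simp_all add: algebra_simps)
  qed
  have "S - T = 1 - x / (1 + x) - y / (1 + y) - z / (1 + z)"
    using minus[of x] minus[of y] minus[of z] pos by (simp add: S_T_def)
  then have 1: "(1 + x) * (1 + y) * (1 + z) * (S - T) = 1 - (x * y + y * z + z * x) - 2 * (x * y * z)"
    using pos by (simp add: divide_simps) (simp add: algebra_simps)
  have "S + T = 1 + x / (1 - x) + y / (1 - y) + z / (1 - z)"
    using plus[of x] plus[of y] plus[of z] pos by (simp add: S_T_def)
  then have 2: "(1 - x) * (1 - y) * (1 - z) * (S + T) = 1 - (x * y + y * z + z * x) + 2 * (x * y * z)"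
    using pos by (simp add: divide_simps) (simp add: algebra_simps)
  have "(1 - x\<^sup>2) * (1 - y\<^sup>2) * (1 - z\<^sup>2) * det ?M =
      ((1 + x) * (1 + y) * (1 + z) * (S - T)) * ((1 - x) * (1 - y) * (1 - z) * (S + T))"
    unfolding det by algebra
  also have "\<dots> = theta_poly a b c u"
    unfolding 1 2 by (simp add: theta_poly_def Let_def power2_eq_square algebra_simps flip: xyz)
  finally show "f u = theta_poly a b c u"
    using route_zeta_eqI[OF pres u] by (simp add: route_zeta_def len mult_ac flip: xyz)
qed

section \<open>Symmetries of the shapes and comparison of two graphs\<close>

lemma figure_eight_swap: "figure_eight E inc f a b s \<Longrightarrow> figure_eight E inc f b a s"
  unfolding figure_eight_def
proof (elim exE conjE)
  fix p q assume "presents E inc f [p, q]" "core [p, q] = {s}"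
    and rest: "src p = s" "tgt p = s" "src q = s" "tgt q = s"
      "length (edges p) = a" "length (edges q) = b"
  moreover have "mset [p, q] = mset [q, p]" by simp
  ultimately have "presents E inc f [q, p]" "core [q, p] = {s}"
    using presents_permute by (metis, auto simp: core_def)
  with rest show "\<exists>p q. presents E inc f [p, q] \<and> core [p, q] = {s} \<and>
     src p = s \<and> tgt p = s \<and> src q = s \<and> tgt q = s \<and>
     length (edges p) = b \<and> length (edges q) = a" by blast
qed

lemma dumbbell_swap: "dumbbell E inc f a b c s t \<Longrightarrow> dumbbell E inc f b a c t s"
  unfolding dumbbell_def
proof (elim exE conjE, intro conjI)
  fix p q r assume pres: "presents E inc f [p, q, r]" and "core [p, q, r] = {s, t}"
    and rest: "src p = s" "tgt p = s" "src q = t" "tgt q = t" "src r = s" "tgt r = t"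
      "length (edges p) = a" "length (edges q) = b" "length (edges r) = c"
  have "presents E inc f [q, p, r]"
    by (rule presents_permute[OF _ pres]) simp
  then have "presents E inc f [q, p, flip r]"
    by (rule presents_reorient[rotated]) simp
  moreover have "core [q, p, flip r] = {t, s}"
    using \<open>core [p, q, r] = {s, t}\<close> by (auto simp: core_def)
  ultimately show "\<exists>p q r. presents E inc f [p, q, r] \<and> core [p, q, r] = {t, s} \<and>
     src p = t \<and> tgt p = t \<and> src q = s \<and> tgt q = s \<and> src r = t \<and> tgt r = s \<and>
     length (edges p) = b \<and> length (edges q) = a \<and> length (edges r) = c"
    using rest by (intro exI[of _ q] exI[of _ p] exI[of _ "flip r"]) simp
qed auto

lemma theta_swap: "theta E inc f a b c s t \<Longrightarrow> theta E inc f b a c s t"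
  and theta_rotate: "theta E inc f a b c s t \<Longrightarrow> theta E inc f b c a s t"
proof -
  assume "theta E inc f a b c s t"
  then obtain p q r where st: "s \<noteq> t" and pres: "presents E inc f [p, q, r]" and core: "core [p, q, r] = {s, t}"
    and rest: "src p = s" "tgt p = t" "src q = s" "tgt q = t" "src r = s" "tgt r = t"
      "length (edges p) = a" "length (edges q) = b" "length (edges r) = c"
    by (auto simp: theta_def)
  have "presents E inc f [q, p, r]" "presents E inc f [q, r, p]"
    by (rule presents_permute[OF _ pres], simp)+
  moreover have "core [q, p, r] = {s, t}" "core [q, r, p] = {s, t}"
    using core by (auto simp: core_def)
  ultimately show "theta E inc f b a c s t" "theta E inc f b c a s t"
    using st rest unfolding theta_def by blast+
qed

text \<open>A transposition and a 3-cycle generate all six orders of the routes.\<close>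

lemma theta_permute:
  assumes "theta E inc f a b c s t" "{#a, b, c#} = {#p, q, r#}"
  shows "theta E inc f p q r s t"
proof -
  have "a = p \<and> b = q \<and> c = r \<or> a = p \<and> b = r \<and> c = q \<or> a = q \<and> b = p \<and> c = r \<or>
        a = q \<and> b = r \<and> c = p \<or> a = r \<and> b = p \<and> c = q \<or> a = r \<and> b = q \<and> c = p"
    using assms(2) by (auto simp: add_eq_conv_ex)
  then show ?thesis
    using assms(1) theta_swap[of E inc f _ _ _ s t] theta_rotate[of E inc f _ _ _ s t] by metis
qed

lemma presents_decomp: "presents E inc f ps \<Longrightarrow> route_decomp E inc ps"
  by (simp add: presents_def)

lemma figure_eight_iso:
  assumes "figure_eight E1 inc1 f a b s" "figure_eight E2 inc2 g a b s'"
  shows "graph_iso E1 inc1 E2 inc2"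
proof -
  obtain p q p' q' where "presents E1 inc1 f [p, q]" "presents E2 inc2 g [p', q']"
    and "core [p, q] = {s}" "core [p', q'] = {s'}"
    and "list_all2 (same_shape (\<lambda>_. s')) [p, q] [p', q']"
    using assms unfolding figure_eight_def same_shape_def by (elim exE conjE) simp
  then show ?thesis
    by (intro graph_iso_if_same_shape[where h = "\<lambda>_. s'"] presents_decomp)
      (auto simp: bij_betw_def)
qed

lemma dumbbell_iso:
  assumes "dumbbell E1 inc1 f a b c s t" "dumbbell E2 inc2 g a b c s' t'"
  shows "graph_iso E1 inc1 E2 inc2"
proof -
  let ?h = "\<lambda>v. if v = s then s' else t'"
  have "s \<noteq> t" "s' \<noteq> t'" using assms by (simp_all add: dumbbell_def)
  then obtain p q r p' q' r' where "presents E1 inc1 f [p, q, r]" "presents E2 inc2 g [p', q', r']"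
    and "core [p, q, r] = {s, t}" "core [p', q', r'] = {s', t'}"
    and "list_all2 (same_shape ?h) [p, q, r] [p', q', r']"
    using assms unfolding dumbbell_def same_shape_def by (elim exE conjE) simp
  then show ?thesis
    using \<open>s \<noteq> t\<close> \<open>s' \<noteq> t'\<close>
    by (intro graph_iso_if_same_shape[where h = ?h] presents_decomp) (auto simp: bij_betw_def)
qed

lemma theta_iso:
  assumes "theta E1 inc1 f a b c s t" "theta E2 inc2 g a b c s' t'"
  shows "graph_iso E1 inc1 E2 inc2"
proof -
  let ?h = "\<lambda>v. if v = s then s' else t'"
  have "s \<noteq> t" "s' \<noteq> t'" using assms by (simp_all add: theta_def)
  then obtain p q r p' q' r' where "presents E1 inc1 f [p, q, r]" "presents E2 inc2 g [p', q', r']"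
    and "core [p, q, r] = {s, t}" "core [p', q', r'] = {s', t'}"
    and "list_all2 (same_shape ?h) [p, q, r] [p', q', r']"
    using assms unfolding theta_def same_shape_def by (elim exE conjE) simp
  then show ?thesis
    using \<open>s \<noteq> t\<close> \<open>s' \<noteq> t'\<close>
    by (intro graph_iso_if_same_shape[where h = ?h] presents_decomp) (auto simp: bij_betw_def)
qed

text \<open>A figure eight counts as a dumbbell with bridge of length 0, whereas a true bridge has
  positive length.\<close>

lemma figure_eight_dumbbell_zeta_neq:
  assumes "figure_eight E1 inc1 f a b s" "dumbbell E2 inc2 g p q r s' t'"
    and eq: "\<And>u. 0 < u \<Longrightarrow> u < 1 \<Longrightarrow> f u = g u"
  shows False
  using dumbbell_poly_inj[of a b p q 0 r] figure_eight_zeta[OF assms(1)] dumbbell_zeta[OF assms(2)] eq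
  by auto

lemma theta_figure_eight_zeta_neq:
  assumes "theta E1 inc1 f a b c s t" "figure_eight E2 inc2 g p q s'"
    and eq: "\<And>u. 0 < u \<Longrightarrow> u < 1 \<Longrightarrow> f u = g u"
  shows False
  using theta_poly_neq_dumbbell_poly[of a b c p q 0] theta_zeta[OF assms(1)] figure_eight_zeta[OF assms(2)] eq
  by auto

lemma theta_dumbbell_zeta_neq:
  assumes "theta E1 inc1 f a b c s t" "dumbbell E2 inc2 g p q r s' t'"
    and eq: "\<And>u. 0 < u \<Longrightarrow> u < 1 \<Longrightarrow> f u = g u"
  shows False
  using theta_poly_neq_dumbbell_poly[of a b c p q r] theta_zeta[OF assms(1)] dumbbell_zeta[OF assms(2)] eq
  by auto

lemma presents_cases:
  assumes "presents E inc f ps"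
  shows "(\<exists>a b s. figure_eight E inc f a b s) \<or> (\<exists>a b c s t. dumbbell E inc f a b c s t)
       \<or> (\<exists>a b c s t. theta E inc f a b c s t)"
proof -
  obtain qs where "presents E inc f qs" "\<forall>v\<in>core qs. 3 \<le> ends qs v"
    using presents_reduce[OF assms] by blast
  then show ?thesis by (rule presents_classify)
qed

lemma figure_eight_zeta_inj:
  assumes "figure_eight E1 inc1 f a b s" "figure_eight E2 inc2 g p q s'"
    and eq: "\<And>u. 0 < u \<Longrightarrow> u < 1 \<Longrightarrow> f u = g u"
  shows "{#a, b#} = {#p, q#}"
  by (rule dumbbell_poly_inj[of _ _ _ _ 0 0, THEN conjunct1])
    (use figure_eight_zeta[OF assms(1)] figure_eight_zeta[OF assms(2)] eq in simp_all)

lemma dumbbell_zeta_inj: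
  assumes "dumbbell E1 inc1 f a b c s t" "dumbbell E2 inc2 g p q r s' t'"
    and eq: "\<And>u. 0 < u \<Longrightarrow> u < 1 \<Longrightarrow> f u = g u"
  shows "{#a, b#} = {#p, q#} \<and> c = r"
  by (rule dumbbell_poly_inj)
    (use dumbbell_zeta[OF assms(1)] dumbbell_zeta[OF assms(2)] eq in simp_all)

lemma theta_zeta_inj:
  assumes "theta E1 inc1 f a b c s t" "theta E2 inc2 g p q r s' t'"
    and eq: "\<And>u. 0 < u \<Longrightarrow> u < 1 \<Longrightarrow> f u = g u"
  shows "{#a, b, c#} = {#p, q, r#}"
  by (rule theta_poly_inj)
    (use theta_zeta[OF assms(1)] theta_zeta[OF assms(2)] eq in simp_all)

lemma presents_iso:
  assumes "presents E1 inc1 f ps" "presents E2 inc2 g qs"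
    and eq: "\<And>u. 0 < u \<Longrightarrow> u < 1 \<Longrightarrow> f u = g u"
  shows "graph_iso E1 inc1 E2 inc2"
  using presents_cases[OF assms(1)] presents_cases[OF assms(2)]
proof (elim disjE exE)
  fix a b s p q s'
  assume 1: "figure_eight E1 inc1 f a b s" and 2: "figure_eight E2 inc2 g p q s'"
  have "figure_eight E1 inc1 f p q s"
    using figure_eight_zeta_inj[OF 1 2 eq] 1 figure_eight_swap[OF 1] by (auto simp: add_eq_conv_ex)
  then show ?thesis using 2 by (rule figure_eight_iso)
next
  fix a b s p q r s' t'
  assume 1: "figure_eight E1 inc1 f a b s" and 2: "dumbbell E2 inc2 g p q r s' t'"
  show ?thesis using figure_eight_dumbbell_zeta_neq[OF 1 2 eq] by simp
next
  fix a b s p q r s' t'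
  assume 1: "figure_eight E1 inc1 f a b s" and 2: "theta E2 inc2 g p q r s' t'"
  show ?thesis using theta_figure_eight_zeta_neq[OF 2 1 eq[symmetric]] by simp
next
  fix a b c s t p q s'
  assume 1: "dumbbell E1 inc1 f a b c s t" and 2: "figure_eight E2 inc2 g p q s'"
  show ?thesis using figure_eight_dumbbell_zeta_neq[OF 2 1 eq[symmetric]] by simp
next
  fix a b c s t p q r s' t'
  assume 1: "dumbbell E1 inc1 f a b c s t" and 2: "dumbbell E2 inc2 g p q r s' t'"
  \<comment> \<open>The loop lengths are known only up to order, and exchanging the loops exchanges
    the core vertices as well.\<close>
  have "dumbbell E1 inc1 f p q r s t \<or> dumbbell E1 inc1 f p q r t s"
    using dumbbell_zeta_inj[OF 1 2 eq] 1 dumbbell_swap[OF 1] by (auto simp: add_eq_conv_ex)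
  then show ?thesis using dumbbell_iso[OF _ 2] by blast
next
  fix a b c s t p q r s' t'
  assume 1: "dumbbell E1 inc1 f a b c s t" and 2: "theta E2 inc2 g p q r s' t'"
  show ?thesis using theta_dumbbell_zeta_neq[OF 2 1 eq[symmetric]] by simp
next
  fix a b c s t p q s'
  assume 1: "theta E1 inc1 f a b c s t" and 2: "figure_eight E2 inc2 g p q s'"
  show ?thesis using theta_figure_eight_zeta_neq[OF 1 2 eq] by simp
next
  fix a b c s t p q r s' t'
  assume 1: "theta E1 inc1 f a b c s t" and 2: "dumbbell E2 inc2 g p q r s' t'"
  show ?thesis using theta_dumbbell_zeta_neq[OF 1 2 eq] by simp
next
  fix a b c s t p q r s' t'
  assume 1: "theta E1 inc1 f a b c s t" and 2: "theta E2 inc2 g p q r s' t'"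
  have "theta E1 inc1 f p q r s t"
    using theta_permute[OF 1 theta_zeta_inj[OF 1 2 eq]] .
  then show ?thesis using 2 by (rule theta_iso)
qed

section \<open>Presentations of graphs of rank two\<close>

lemma connected_graph_closed:
  assumes "connected_graph E inc" "v \<in> S"
    and closed: "\<And>e x y. e \<in> E \<Longrightarrow> inc e = {#x, y#} \<Longrightarrow> x \<in> S \<Longrightarrow> y \<in> S"
  shows "S = UNIV"
proof -
  have "w \<in> S" for w
  proof -
    have "(adjacent E inc)\<^sup>*\<^sup>* v w" using assms(1) by (simp add: connected_graph_def)
    then show ?thesis
      by induction (use assms(2) closed in \<open>auto simp: adjacent_def\<close>)
  qed
  then show ?thesis by blast
qed

text \<open>For routes of length 1 the weight is \<open>t = u\<close>, so the factor
  \<open>1 - u\<^sup>2\<close> clears all denominators. On the identity it leaves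
  \<open>- u\<^sup>2\<close>, which is the \<open>- 1\<close> in \<open>Q_matrix\<close>.\<close>

lemma ihara_matrix_route_matrix:
  fixes inc :: "'e \<Rightarrow> ('v::finite) multiset"
  assumes inc: "\<And>e. e \<in> set es \<Longrightarrow> inc e = {#x e, y e#}" and "distinct es" and u: "u\<^sup>2 \<noteq> 1"
  shows "mat 1 - u *\<^sub>R adj_matrix (set es) inc + u\<^sup>2 *\<^sub>R Q_matrix (set es) inc
    = (1 - u\<^sup>2) *\<^sub>R route_matrix u (map (\<lambda>e. Route (x e) [] (y e) [e]) es)"
proof -
  have sum: "(1 - u\<^sup>2) * (\<Sum>e\<leftarrow>es. weight u (Route (x e) [] (y e) [e]) i j) =
      of_bool (i = j) * u\<^sup>2 * degree (set es) inc i
      - (if i = j then 2 else 1) * u * card {e\<in>set es. inc e = {#i, j#}}" for i j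
  proof -
    \<comment> \<open>A loop at \<open>i\<close> has \<open>count (inc e) i = 2\<close> and meets
      both off-diagonal conditions of \<open>weight\<close>; the factor 2 for \<open>i = j\<close>
      matches the doubled loops of \<open>adj_matrix\<close>.\<close>
    have "(1 - u\<^sup>2) * weight u (Route (x e) [] (y e) [e]) i j =
        of_bool (i = j) * u\<^sup>2 * count (inc e) i
        - (if i = j then 2 else 1) * u * of_bool (inc e = {#i, j#})" if "e \<in> set es" for e
    proof -
      define D where "D = 1 - u\<^sup>2"
      have "D \<noteq> 0" using u by (simp add: D_def)
      then have "D * weight u (Route (x e) [] (y e) [e]) i j =
          of_bool (i = j) * (of_bool (i = x e) + of_bool (i = y e)) * u\<^sup>2
          - (of_bool (i = x e \<and> j = y e) + of_bool (i = y e \<and> j = x e)) * u"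
        by (simp add: weight_def Let_def right_diff_distrib flip: D_def)
      then show ?thesis
        by (auto simp: inc[OF that] add_eq_conv_ex simp flip: D_def)
    qed
    then have "(\<Sum>e\<in>set es. (1 - u\<^sup>2) * weight u (Route (x e) [] (y e) [e]) i j) =
        (\<Sum>e\<in>set es. of_bool (i = j) * u\<^sup>2 * count (inc e) i
          - (if i = j then 2 else 1) * u * of_bool (inc e = {#i, j#}))"
      by simp
    also have "\<dots> = of_bool (i = j) * u\<^sup>2 * degree (set es) inc i
      - (if i = j then 2 else 1) * u * (\<Sum>e\<in>set es. of_bool (inc e = {#i, j#}))"
      by (simp only: sum_subtractf degree_def of_nat_sum sum_distrib_left)
    also have "(\<Sum>e\<in>set es. of_bool (inc e = {#i, j#})) = real (card {e\<in>set es. inc e = {#i, j#}})"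
      by (simp add: Int_def)
    finally show ?thesis
      using \<open>distinct es\<close> by (simp only: sum_list_distinct_conv_sum_set sum_distrib_left)
  qed
  show ?thesis
    unfolding vec_eq_iff
  proof (intro allI)
    fix i j
    show "(mat 1 - u *\<^sub>R adj_matrix (set es) inc + u\<^sup>2 *\<^sub>R Q_matrix (set es) inc) $ i $ j
      = ((1 - u\<^sup>2) *\<^sub>R route_matrix u (map (\<lambda>e. Route (x e) [] (y e) [e]) es)) $ i $ j"
      using sum[of i j]
      by (cases "i = j") (simp_all add: route_matrix_def o_def adj_matrix_def Q_matrix_def mat_def
          distrib_left right_diff_distrib)
  qed
qed

text \<open>Before any contraction each edge is a route of its own and every vertex is in the
  core.\<close>

lemma ex_presents:
  fixes inc :: "'e \<Rightarrow> ('v::finite) multiset"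
  assumes graph: "multigraph E inc" and conn: "connected_graph E inc"
    and deg: "\<forall>v. degree E inc v \<noteq> 1" and rank: "graph_rank E inc = 2"
  shows "\<exists>ps. presents E inc (ihara_zeta_recip E inc) ps"
proof -
  have "\<forall>e\<in>E. \<exists>a b. inc e = {#a, b#}"
  proof
    fix e assume "e \<in> E"
    then have "size (inc e) = 2" using graph by (simp add: multigraph_def)
    moreover obtain vs where "mset vs = inc e" using ex_mset by blast
    ultimately have "length vs = 2" by (metis size_mset)
    then obtain a b where "vs = [a, b]" by (auto simp: numeral_2_eq_2 length_Suc_conv)
    then show "\<exists>a b. inc e = {#a, b#}" using \<open>mset vs = inc e\<close>[symmetric] by auto
  qed
  then obtain x y where inc: "\<And>e. e \<in> E \<Longrightarrow> inc e = {#x e, y e#}"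
    by metis
  obtain es where es: "set es = E" "distinct es"
    using graph finite_distinct_list unfolding multigraph_def by metis
  let ?r = "\<lambda>e. Route (x e) [] (y e) [e]"
  define ps where "ps = map ?r es"
  have core: "core ps = UNIV" by (simp add: core_def ps_def)
  have ends: "ends ps v = degree E inc v" for v
  proof -
    have "ends ps v = (\<Sum>e\<in>E. of_bool (x e = v) + of_bool (y e = v))"
      using es by (simp add: ends_def ps_def o_def sum_list_distinct_conv_sum_set)
    also have "\<dots> = degree E inc v"
      unfolding degree_def by (rule sum.cong) (auto simp: inc)
    finally show ?thesis .
  qed
  have card: "card E = Suc CARD('v)" using rank by (simp add: graph_rank_def)
  have len: "length ps = card E" using es by (metis distinct_card length_map ps_def)
  have concat: "concat (map mids ps) = []" "concat (map edges ps) = es"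
    by (simp_all add: ps_def o_def)
  have "route_decomp E inc ps"
    unfolding route_decomp_def core concat using es inc by (simp add: is_route_def ps_def)
  moreover have rc: "route_connected ps"
    unfolding route_connected_def
  proof (intro allI impI)
    fix S :: "'v set" assume "S \<noteq> {}" and closed: "\<forall>p\<in>set ps. src p \<in> S \<longleftrightarrow> tgt p \<in> S"
    then obtain v where "v \<in> S" by blast
    have "S = UNIV"
    proof (rule connected_graph_closed[OF conn \<open>v \<in> S\<close>])
      fix e a b assume e: "e \<in> E" "inc e = {#a, b#}" "a \<in> S"
      then have "x e \<in> S \<longleftrightarrow> y e \<in> S" using closed es by (auto simp: ps_def)
      then show "b \<in> S" using e inc[of e] by (auto simp: add_eq_conv_ex)
    qed
    then show "S = core ps" by (simp add: core)
  qed
  moreover have "2 \<le> ends ps v" for v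
  proof -
    \<comment> \<open>An isolated vertex would be the whole graph by connectedness, but rank two
      guarantees an edge, which needs an end elsewhere.\<close>
    have "ends ps v \<noteq> 0"
    proof
      assume "ends ps v = 0"
      note off = ends_eq_0[OF this]
      then have "{v} = core ps"
        using rc unfolding route_connected_def by (metis core empty_not_insert singletonD subset_UNIV)
      moreover have "ps \<noteq> []" using len card by auto
      then have "src (hd ps) \<noteq> v" using off by simp
      ultimately show False using core by blast
    qed
    moreover have "ends ps v \<noteq> 1" using deg by (simp add: ends)
    ultimately show ?thesis by linarith
  qed
  moreover have "route_zeta ps u = ihara_zeta_recip E inc u" if u: "0 < u" "u < 1" for u
  proof -
    have "u\<^sup>2 < 1" using u by (simp add: abs_square_less_1)
    then have "det (mat 1 - u *\<^sub>R adj_matrix E inc + u\<^sup>2 *\<^sub>R Q_matrix E inc)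
        = (1 - u\<^sup>2) ^ CARD('v) * det (route_matrix u ps)"
      using ihara_matrix_route_matrix[of es inc x y u] inc es
      by (simp add: det_scaleR flip: ps_def)
    moreover have "(\<Prod>p\<leftarrow>ps. 1 - (u ^ length (edges p))\<^sup>2) = (1 - u\<^sup>2) ^ card E"
      unfolding len[symmetric] by (simp add: ps_def o_def map_replicate_const)
    \<comment> \<open>The product over the edges has one factor \<open>1 - u\<^sup>2\<close> more
      than the determinant absorbs; it is the prefactor of exponent
      \<open>r - 1 = 1\<close>.\<close>
    ultimately show ?thesis
      by (simp add: route_zeta_def ihara_zeta_recip_def rank card)
  qed
  ultimately have "presents E inc (ihara_zeta_recip E inc) ps"
    by (simp add: presents_def len core card)
  then show ?thesis by blast
qed

text \<open>An isomorphism preserves degrees and edge multiplicities, so it relabels rows and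
  columns of the Ihara matrix simultaneously.\<close>

lemma graph_iso_ihara_zeta_recip:
  fixes inc1 :: "'e1 \<Rightarrow> ('v1::finite) multiset" and inc2 :: "'e2 \<Rightarrow> ('v2::finite) multiset"
  assumes "graph_iso E1 inc1 E2 inc2"
  shows "ihara_zeta_recip E1 inc1 = ihara_zeta_recip E2 inc2"
proof
  fix u
  obtain f g where f: "bij f" and g: "bij_betw g E1 E2"
    and inc: "\<And>e. e \<in> E1 \<Longrightarrow> inc2 (g e) = image_mset f (inc1 e)"
    using assms by (auto simp: graph_iso_def)
  have inj: "inj f" using f by (rule bij_is_inj)
  have "card E1 = card E2" "CARD('v1) = CARD('v2)"
    using f g by (simp_all add: bij_betw_same_card)
  then have rank: "graph_rank E1 inc1 = graph_rank E2 inc2"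
    by (simp add: graph_rank_def)
  have "count (image_mset f M) (f v) = count M v" for M v
    by (induction M) (auto simp: inj_eq[OF inj])
  then have degree: "degree E2 inc2 (f v) = degree E1 inc1 v" for v
    unfolding degree_def using sum.reindex_bij_betw[OF g, of "\<lambda>e. count (inc2 e) (f v)"]
    by (simp add: inc)
  have card: "card {e\<in>E2. inc2 e = {#f v, f w#}} = card {e\<in>E1. inc1 e = {#v, w#}}" for v w
  proof -
    have iff: "inc2 (g e) = {#f v, f w#} \<longleftrightarrow> inc1 e = {#v, w#}" if "e \<in> E1" for e
      using injD[OF multiset.inj_map[OF inj], of "inc1 e" "{#v, w#}"] inc[OF that] by auto
    have "g ` {e\<in>E1. inc1 e = {#v, w#}} = {e\<in>E2. inc2 e = {#f v, f w#}}"
      using g iff by (auto simp: bij_betw_def)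
    moreover have "inj_on g {e\<in>E1. inc1 e = {#v, w#}}"
      using g by (auto simp: bij_betw_def intro: inj_on_subset)
    ultimately show ?thesis
      using card_image[of g "{e\<in>E1. inc1 e = {#v, w#}}"] by simp
  qed
  let ?M1 = "mat 1 - u *\<^sub>R adj_matrix E1 inc1 + u\<^sup>2 *\<^sub>R Q_matrix E1 inc1"
  let ?M2 = "mat 1 - u *\<^sub>R adj_matrix E2 inc2 + u\<^sup>2 *\<^sub>R Q_matrix E2 inc2"
  have M: "?M1 = (\<chi> i j. ?M2 $ f i $ f j)"
    by (simp add: vec_eq_iff mat_def adj_matrix_def Q_matrix_def degree card inj_eq[OF inj])
  have "det ?M1 = det ?M2"
    unfolding M by (rule det_reindex[OF f])
  then show "ihara_zeta_recip E1 inc1 u = ihara_zeta_recip E2 inc2 u"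
    by (simp add: ihara_zeta_recip_def rank)
qed

theorem theorem3:
  fixes E1 :: "'e1 set" and inc1 :: "'e1 \<Rightarrow> ('v1::finite) multiset"
    and E2 :: "'e2 set" and inc2 :: "'e2 \<Rightarrow> ('v2::finite) multiset"
  assumes "multigraph E1 inc1" and "connected_graph E1 inc1"
    and "\<forall>v. degree E1 inc1 v \<noteq> 1" and "graph_rank E1 inc1 = 2"
    and "multigraph E2 inc2" and "connected_graph E2 inc2"
    and "\<forall>v. degree E2 inc2 v \<noteq> 1" and "graph_rank E2 inc2 = 2"
  shows "graph_iso E1 inc1 E2 inc2 \<longleftrightarrow> (\<forall>u. ihara_zeta E1 inc1 u = ihara_zeta E2 inc2 u)"
proof
  assume "graph_iso E1 inc1 E2 inc2"
  then show "\<forall>u. ihara_zeta E1 inc1 u = ihara_zeta E2 inc2 u"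
    unfolding ihara_zeta_def by (simp only: graph_iso_ihara_zeta_recip) simp
next
  assume "\<forall>u. ihara_zeta E1 inc1 u = ihara_zeta E2 inc2 u"
  \<comment> \<open>With \<open>inverse 0 = 0\<close>, \<open>inverse\<close> is injective on all
    reals, so the equality passes to the reciprocals at every \<open>u\<close>, poles
    included.\<close>
  then have eq: "ihara_zeta_recip E1 inc1 u = ihara_zeta_recip E2 inc2 u" for u
    by (simp add: ihara_zeta_def)
  obtain ps qs where "presents E1 inc1 (ihara_zeta_recip E1 inc1) ps"
      "presents E2 inc2 (ihara_zeta_recip E2 inc2) qs"
    using ex_presents[OF assms(1-4)] ex_presents[OF assms(5-8)] by blast
  then show "graph_iso E1 inc1 E2 inc2"
    by (rule presents_iso) (rule eq)
qed

end
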